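(* Let $\{W(s,t) : s,t\in[0,\infty)\}$ be a standard Wiener field and let $X(s,t):=\mathrm{e}^{-\frac{s}{2}-\frac{t}{2}}\,W(\mathrm{e}^{s},\mathrm{e}^{t})$, $s,t\in\mathbb{R}$, which is a stationary Ornstein-Uhlenbeck field with parameters $(\frac12,\frac12,1)$. Then the random field $\{U(s,t):(s,t)\in[0,1]^2\}$ defined by $$U(s,t):=\begin{cases}\sqrt{st(1-s)(1-t)}\;X\!\left(\ln\!\left(\frac{s}{1-s}\right),\ln\!\left(\frac{t}{1-t}\right)\right) & \text{if } (s,t)\in(0,1)^2,\\ 0 & \text{if } s\in\{0,1\}\text{ or } t\in\{0,1\},\end{cases}$$ generates the same law on $C([0,1]^2)$ as a tied-down Wiener bridge $B_*$.
   Context: A random field $\{Y(s,t):(s,t)\in D\}$, $D\subseteq\mathbb{R}^2$, is a Gauss field if all its finite-dimensional distributions are (possibly degenerate) multivariate normal. It has continuous sample paths almost surely if $\mathbb{P}(\{\omega: D\ni(s,t)\mapsto Y(s,t)(\omega)\text{ is continuous}\})=1$. $C(D)$ is the space of continuous real-valued functions on $D$. Two fields generate the same law on $C(D)$ if both have continuous sample paths almost surely and the induced probability laws on $C(D)$ coincide. A standard Wiener field is a zero-mean Gauss field $\{W(s,t):s,t\in[0,\infty)\}$ with continuous sample paths almost surely and $\operatorname{Cov}(W(s_1,t_1),W(s_2,t_2))=\min(s_1,s_2)\min(t_1,t_2)$. For $\alpha,\beta,\sigma>0$, a stationary Ornstein-Uhlenbeck field with parameters $(\alpha,\beta,\sigma)$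 is a zero-mean Gauss field $\{X(s,t):s,t\in\mathbb{R}\}$ with continuous sample paths almost surely and $\operatorname{Cov}(X(s_1,t_1),X(s_2,t_2))=\frac{\sigma^2}{4\alpha\beta}\exp\{-\alpha|s_2-s_1|-\beta|t_2-t_1|\}$. A tied-down Wiener bridge is the field $B_*(s,t):=W(s,t)-sW(1,t)-tW(s,1)+stW(1,1)$, $s,t\in[0,1]$, where $W$ is a standard Wiener field; it is a zero-mean Gauss field with continuous sample paths almost surely and covariance function $\operatorname{Cov}(B_*(s_1,t_1),B_*(s_2,t_2))=(\min(s_1,s_2)-s_1s_2)(\min(t_1,t_2)-t_1t_2)$. *)

theory Defs
  imports "HOL-Probability.Probability"
begin

text \<open>
  A field over an index set \<open>D\<close> of points of the plane is a function \<open>Y\<close> with \<open>Y (s, t) \<omega>\<close> the value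
  at \<open>(s, t)\<close>. Only the values at points of \<open>D\<close> and outcomes in \<open>space M\<close> matter.
\<close>

definition random_field ::
  "'w measure \<Rightarrow> (real \<times> real) set \<Rightarrow> (real \<times> real \<Rightarrow> 'w \<Rightarrow> real) \<Rightarrow> bool"
  where "random_field M D Y \<longleftrightarrow> prob_space M \<and> (\<forall>z\<in>D. Y z \<in> borel_measurable M)"

definition normal_law :: "real \<Rightarrow> real \<Rightarrow> real measure"
  where "normal_law \<mu> \<sigma> =
    (if \<sigma> = 0 then return borel \<mu> else density lborel (\<lambda>x. ennreal (normal_density \<mu> \<sigma> x)))"

text \<open>
  A law on \<open>\<real>\<^sup>I\<close>, \<open>I\<close> finite, is (possibly degenerate) multivariate normal if every linear
  combination of the coordinates is normally distributed, point masses being the normal laws of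
  variance zero.
\<close>

definition multivariate_normal :: "'i set \<Rightarrow> ('i \<Rightarrow> real) measure \<Rightarrow> bool"
  where "multivariate_normal I P \<longleftrightarrow>
    finite I \<and> sets P = sets (Pi\<^sub>M I (\<lambda>_. borel)) \<and>
    (\<forall>a. \<exists>\<mu> \<sigma>. 0 \<le> \<sigma> \<and> distr P borel (\<lambda>x. \<Sum>i\<in>I. a i * x i) = normal_law \<mu> \<sigma>)"

definition gauss_field ::
  "'w measure \<Rightarrow> (real \<times> real) set \<Rightarrow> (real \<times> real \<Rightarrow> 'w \<Rightarrow> real) \<Rightarrow> bool"
  where "gauss_field M D Y \<longleftrightarrow> random_field M D Y \<and>
    (\<forall>I. finite I \<and> I \<subseteq> D \<longrightarrow>
      multivariate_normal I (distr M (Pi\<^sub>M I (\<lambda>_. borel)) (\<lambda>\<omega>. \<lambda>z\<in>I. Y z \<omega>)))"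

text \<open>
  The set of outcomes with a continuous path is an uncountable intersection and need not be an
  event, so probability one is read as: the complement lies in a null event.
\<close>

definition continuous_paths_AE ::
  "'w measure \<Rightarrow> (real \<times> real) set \<Rightarrow> (real \<times> real \<Rightarrow> 'w \<Rightarrow> real) \<Rightarrow> bool"
  where "continuous_paths_AE M D Y \<longleftrightarrow> (AE \<omega> in M. continuous_on D (\<lambda>z. Y z \<omega>))"

definition covariance :: "'w measure \<Rightarrow> ('w \<Rightarrow> real) \<Rightarrow> ('w \<Rightarrow> real) \<Rightarrow> real"
  where "covariance M X Y =
    (\<integral>\<omega>. (X \<omega> - integral\<^sup>L M X) * (Y \<omega> - integral\<^sup>L M Y) \<partial>M)"

definition standard_Wiener_field :: "'w measure \<Rightarrow> (real \<times> real \<Rightarrow> 'w \<Rightarrow> real) \<Rightarrow> bool"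
  where "standard_Wiener_field M W \<longleftrightarrow>
    gauss_field M ({0..} \<times> {0..}) W \<and>
    continuous_paths_AE M ({0..} \<times> {0..}) W \<and>
    (\<forall>s\<ge>0. \<forall>t\<ge>0. integral\<^sup>L M (W (s, t)) = 0) \<and>
    (\<forall>s1\<ge>0. \<forall>t1\<ge>0. \<forall>s2\<ge>0. \<forall>t2\<ge>0.
      covariance M (W (s1, t1)) (W (s2, t2)) = min s1 s2 * min t1 t2)"

definition stationary_OU_field ::
  "'w measure \<Rightarrow> real \<Rightarrow> real \<Rightarrow> real \<Rightarrow> (real \<times> real \<Rightarrow> 'w \<Rightarrow> real) \<Rightarrow> bool"
  where "stationary_OU_field M \<alpha> \<beta> \<sigma> X \<longleftrightarrow>
    0 < \<alpha> \<and> 0 < \<beta> \<and> 0 < \<sigma> \<and>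
    gauss_field M UNIV X \<and>
    continuous_paths_AE M UNIV X \<and>
    (\<forall>s t. integral\<^sup>L M (X (s, t)) = 0) \<and>
    (\<forall>s1 t1 s2 t2. covariance M (X (s1, t1)) (X (s2, t2)) =
      \<sigma>\<^sup>2 / (4 * \<alpha> * \<beta>) * exp (- \<alpha> * \<bar>s2 - s1\<bar> - \<beta> * \<bar>t2 - t1\<bar>))"

definition tied_down_Wiener_bridge :: "'w measure \<Rightarrow> (real \<times> real \<Rightarrow> 'w \<Rightarrow> real) \<Rightarrow> bool"
  where "tied_down_Wiener_bridge M B \<longleftrightarrow>
    (\<exists>W. standard_Wiener_field M W \<and>
      (\<forall>s\<in>{0..1}. \<forall>t\<in>{0..1}. \<forall>\<omega>\<in>space M.
        B (s, t) \<omega> = W (s, t) \<omega> - s * W (1, t) \<omega> - t * W (s, 1) \<omega> + s * t * W (1, 1) \<omega>))"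

text \<open>
  \<open>C(D)\<close> for compact \<open>D\<close>, with the supremum metric and its Borel \<open>\<sigma>\<close>-algebra. The points of
  \<^const>\<open>cfunspace\<close> are the bounded continuous functions that are \<^const>\<open>undefined\<close> outside \<open>D\<close>;
  boundedness is automatic for compact \<open>D\<close>.
\<close>

definition borel_C :: "(real \<times> real) set \<Rightarrow> (real \<times> real \<Rightarrow> real) measure"
  where "borel_C D =
    sigma (mspace (cfunspace (top_of_set D) euclidean_metric))
      {U. openin (mtopology_of (cfunspace (top_of_set D) euclidean_metric)) U}"

lemma space_borel_C:
  assumes "compact D"
  shows "space (borel_C D) = {f \<in> extensional D. continuous_on D f}"
proof -
  have "compactin (top_of_set D) (topspace (top_of_set D))"
    using assms by (simp add: compactin_subtopology)
  then show ?thesis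
    unfolding borel_C_def space_measure_of_conv
    by (subst compactin_mspace_cfunspace) auto
qed

text \<open>
  The path of the field as an element of \<open>C(D)\<close>; on the exceptional null set of outcomes with a
  discontinuous path it is replaced by the zero function.
\<close>

definition C_path ::
  "(real \<times> real) set \<Rightarrow> (real \<times> real \<Rightarrow> 'w \<Rightarrow> real) \<Rightarrow> 'w \<Rightarrow> (real \<times> real \<Rightarrow> real)"
  where "C_path D Y \<omega> = (\<lambda>z\<in>D. if continuous_on D (\<lambda>z. Y z \<omega>) then Y z \<omega> else 0)"

text \<open>
  The completion of \<open>M\<close> makes the exceptional set measurable. As \<^const>\<open>distr\<close> is meaningless
  for non-measurable maps, measurability of the path maps is part of the notion.
\<close>

definition law_on_C ::
  "(real \<times> real) set \<Rightarrow> 'w measure \<Rightarrow> (real \<times> real \<Rightarrow> 'w \<Rightarrow> real) \<Rightarrow> (real \<times> real \<Rightarrow> real) measure"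
  where "law_on_C D M Y = distr (completion M) (borel_C D) (C_path D Y)"

definition same_law_on_C ::
  "(real \<times> real) set \<Rightarrow> 'v measure \<Rightarrow> (real \<times> real \<Rightarrow> 'v \<Rightarrow> real) \<Rightarrow>
    'w measure \<Rightarrow> (real \<times> real \<Rightarrow> 'w \<Rightarrow> real) \<Rightarrow> bool"
  where "same_law_on_C D M Y N Z \<longleftrightarrow>
    random_field M D Y \<and> random_field N D Z \<and>
    continuous_paths_AE M D Y \<and> continuous_paths_AE N D Z \<and>
    C_path D Y \<in> completion M \<rightarrow>\<^sub>M borel_C D \<and> C_path D Z \<in> completion N \<rightarrow>\<^sub>M borel_C D \<and>
    law_on_C D M Y = law_on_C D N Z"

end

theory Submission
  imports Defs
begin

text \<open>
  Cancelling the time changes shows that \<open>U (s, t) = (1 - s) (1 - t) W (s / (1 - s), t / (1 - t))\<close> in the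
  interior of the unit square. Hence \<open>X\<close> and \<open>U\<close>, like the bridge \<open>B\<close>, are linear images of a Wiener field,
  and are centred Gauss fields whose covariances can be computed
  (\<open>centered_gaussian_linear_image\<close>). For \<open>X\<close> this is the Ornstein-Uhlenbeck covariance, and \<open>U\<close> and \<open>B\<close>
  have the same covariance \<open>(min s s' - s s') (min t t' - t t')\<close>. A centred Gaussian law is determined by
  its covariance, which rests on the uniqueness theorem for characteristic functions in several
  variables (\<open>joint_law_determined_by_characteristic_function\<close>); so \<open>U\<close> and \<open>B\<close> have the same joint law
  on every set of points (\<open>centered_gaussian_law_unique\<close>).

  What remains is to pass to laws on \<open>C([0,1]\<^sup>2)\<close>, and first of all to show that \<open>U\<close> is continuous at
  the boundary, that is, that \<open>W (u, v)\<close> is small compared with \<open>(1 + u) (1 + v)\<close> when \<open>u\<close> or \<open>v\<close> is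
  large. This is deduced from the continuity of the bridge. On a countable dense set \<open>Q\<close> of points, the event that the field is uniformly
  continuous has the same probability for \<open>U\<close> as for \<open>B\<close>, namely one
  (\<open>AE_uniformly_continuous_transfer\<close>). A path that is uniformly continuous on \<open>Q\<close>, continuous in
  the interior and zero on the boundary is continuous on the square, provided that \<open>Q\<close> is dense in both parts
  (\<open>continuous_on_Union_dense\<close>). Finally, the Borel sets of \<open>C(D)\<close> are generated by the evaluations on
  a countable dense set (\<open>sets_borel_C_subset\<close>), so that the joint law of the values on \<open>Q\<close> determines
  the law on \<open>C(D)\<close>.
\<close>

section \<open>Uniqueness of characteristic functions in several variables\<close>

text \<open>
  Levy's uniqueness theorem concerns probability measures, whereas the proof of the multivariate
  version below needs it for the pushforward of \<open>g \<cdot> M\<close> under \<open>X\<close>, with a bounded nonnegative weight \<open>g\<close>.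
  Dividing by the total mass turns the one into the other.
\<close>

lemma tilted_law:
  fixes X g :: "'a \<Rightarrow> real"
  assumes "prob_space M" and [measurable]: "X \<in> borel_measurable M" "g \<in> borel_measurable M"
    and g: "\<And>\<omega>. 0 \<le> g \<omega>" "\<And>\<omega>. g \<omega> \<le> c"
    and pos: "0 < (\<integral>\<omega>. g \<omega> \<partial>M)"
  defines "m \<equiv> \<integral>\<omega>. g \<omega> \<partial>M"
  defines "\<mu> \<equiv> distr (density M (\<lambda>\<omega>. ennreal (g \<omega> / m))) borel X"
  shows "real_distribution \<mu>"
    and "char \<mu> t = (CLINT \<omega>|M. complex_of_real (g \<omega>) * iexp (t * X \<omega>)) / m"
    and "A \<in> sets borel \<Longrightarrow> measure \<mu> A = (\<integral>\<omega>. g \<omega> * indicator A (X \<omega>) \<partial>M) / m"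
proof -
  interpret prob_space M by fact
  have m: "0 < m" using pos by (simp add: m_def)
  have int: "integrable M g"
    by (rule integrable_const_bound[of _ c]) (use g in auto)
  have "(\<integral>\<^sup>+ \<omega>. ennreal (g \<omega> / m) \<partial>M) = ennreal (\<integral>\<omega>. g \<omega> / m \<partial>M)"
    by (rule nn_integral_eq_integral) (use int g m in auto)
  also have "\<dots> = 1" using m by (simp add: m_def)
  finally have "prob_space (density M (\<lambda>\<omega>. ennreal (g \<omega> / m)))"
    by (intro prob_spaceI) (simp add: emeasure_density cong: nn_integral_cong)
  then interpret D: prob_space "density M (\<lambda>\<omega>. ennreal (g \<omega> / m))" .
  interpret mu: real_distribution \<mu>
    unfolding \<mu>_def by (rule D.real_distribution_distr) simp
  show "real_distribution \<mu>" by (rule mu.real_distribution_axioms)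
  show "char \<mu> t = (CLINT \<omega>|M. complex_of_real (g \<omega>) * iexp (t * X \<omega>)) / m"
    unfolding \<mu>_def char_def
    by (subst integral_distr, simp, simp, subst integral_density)
       (use g m in \<open>auto simp: scaleR_conv_of_real\<close>)
  assume [measurable]: "A \<in> sets borel"
  have "measure \<mu> A = (\<integral>x. indicator A x \<partial>\<mu>)"
    by (simp add: \<mu>_def)
  also have "\<dots> = (\<integral>\<omega>. g \<omega> * indicator A (X \<omega>) \<partial>M) / m"
    unfolding \<mu>_def
    by (subst integral_distr, simp, simp, subst integral_density)
       (use g m in \<open>auto\<close>)
  finally show "measure \<mu> A = (\<integral>\<omega>. g \<omega> * indicator A (X \<omega>) \<partial>M) / m" .
qed

lemma weighted_law_unique:
  fixes X g :: "'a \<Rightarrow> real" and Y h :: "'b \<Rightarrow> real"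
  assumes M: "prob_space M" and [measurable]: "X \<in> borel_measurable M" "g \<in> borel_measurable M"
    and g: "\<And>\<omega>. 0 \<le> g \<omega>" "\<And>\<omega>. g \<omega> \<le> c"
    and N: "prob_space N" and [measurable]: "Y \<in> borel_measurable N" "h \<in> borel_measurable N"
    and h: "\<And>\<omega>. 0 \<le> h \<omega>" "\<And>\<omega>. h \<omega> \<le> c"
    and eq: "\<And>t. (CLINT \<omega>|M. complex_of_real (g \<omega>) * iexp (t * X \<omega>)) =
      (CLINT \<omega>|N. complex_of_real (h \<omega>) * iexp (t * Y \<omega>))"
    and [measurable]: "A \<in> sets borel"
  shows "(\<integral>\<omega>. g \<omega> * indicator A (X \<omega>) \<partial>M) = (\<integral>\<omega>. h \<omega> * indicator A (Y \<omega>) \<partial>N)"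
proof -
  interpret M: prob_space M by fact
  interpret N: prob_space N by fact
  have mass: "(\<integral>\<omega>. g \<omega> \<partial>M) = (\<integral>\<omega>. h \<omega> \<partial>N)"
    using eq[of 0] by (simp add: integral_complex_of_real)
  have int: "integrable M g" "integrable N h"
    by (rule M.integrable_const_bound[of _ c] N.integrable_const_bound[of _ c]; use g h in simp)+
  have "0 \<le> (\<integral>\<omega>. g \<omega> \<partial>M)" using g by simp
  then consider "(\<integral>\<omega>. g \<omega> \<partial>M) = 0" | "0 < (\<integral>\<omega>. g \<omega> \<partial>M)" by fastforce
  then show ?thesis
  proof cases
    case 1
    have "AE \<omega> in M. g \<omega> = 0"
      using integral_nonneg_eq_0_iff_AE[OF int(1)] g 1 by simp
    moreover have "AE \<omega> in N. h \<omega> = 0"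
      using integral_nonneg_eq_0_iff_AE[OF int(2)] h 1 mass by simp
    ultimately have "AE \<omega> in M. g \<omega> * indicator A (X \<omega>) = 0" "AE \<omega> in N. h \<omega> * indicator A (Y \<omega>) = 0"
      by auto
    then show ?thesis by (simp only: integral_eq_zero_AE)
  next
    case 2
    note tM = tilted_law[OF M assms(2,3) g 2]
    note tN = tilted_law[OF N assms(7,8) h 2[unfolded mass]]
    have "distr (density M (\<lambda>\<omega>. ennreal (g \<omega> / (\<integral>\<omega>. g \<omega> \<partial>M)))) borel X =
      distr (density N (\<lambda>\<omega>. ennreal (h \<omega> / (\<integral>\<omega>. h \<omega> \<partial>N)))) borel Y"
      by (rule Levy_uniqueness[OF tM(1) tN(1)]) (rule ext, subst tM(2), subst tN(2), simp only: eq mass)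
    then show ?thesis
      using 2 mass tM(3)[of A] tN(3)[of A] by simp
  qed
qed

text \<open>
  The shape in which the weight \<open>1 + cos \<theta>\<close> is written as a combination of exponentials below.
\<close>

lemma integral_combination:
  fixes f :: "'a \<Rightarrow> complex"
  assumes "integrable M f" "integrable M g" "integrable M h"
  shows "(\<integral>x. f x + (c * g x + d * h x) / 2 \<partial>M) =
    integral\<^sup>L M f + (c * integral\<^sup>L M g + d * integral\<^sup>L M h) / 2"
  using assms by simp

text \<open>
  Finite-dimensional laws are determined by their characteristic function. The coordinates are
  moved one at a time from the exponential into indicator functions: by induction on \<open>J\<close>,
  \[ E \Big[ \prod_{j \in J} 1_{A_j}(Y_j) \, e^{i \theta} \Big], \qquad \theta = \sum_{i \in I} a_i Y_i, \]
  depends only on the characteristic function. To add a coordinate \<open>j\<close>, the one-dimensional uniqueness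
  theorem is applied to \<open>Y\<^sub>j\<close> under the nonnegative weights \<open>(1 + cos (\<theta> + p)) \<cdot> \<Prod> 1\<close>: their Fourier
  transforms in direction \<open>j\<close> are combinations of expectations covered by the induction hypothesis,
  because \<open>a\<close> is arbitrary there and ranges over all of \<open>I\<close>. The phases \<open>p = 0\<close> and \<open>p = - \<pi> / 2\<close>
  recover the real and the imaginary part of \<open>e\<^sup>i\<^sup>\<theta>\<close>.
\<close>

theorem joint_law_determined_by_characteristic_function:
  fixes Y :: "'i \<Rightarrow> 'a \<Rightarrow> real" and Z :: "'i \<Rightarrow> 'b \<Rightarrow> real"
  assumes M: "prob_space M" and N: "prob_space N" and I: "finite I"
    and Y: "\<And>i. i \<in> I \<Longrightarrow> Y i \<in> borel_measurable M"
    and Z: "\<And>i. i \<in> I \<Longrightarrow> Z i \<in> borel_measurable N"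
    and char_eq: "\<And>a. (CLINT \<omega>|M. iexp (\<Sum>i\<in>I. a i * Y i \<omega>)) =
      (CLINT \<omega>|N. iexp (\<Sum>i\<in>I. a i * Z i \<omega>))"
    and A: "\<And>i. i \<in> I \<Longrightarrow> A i \<in> sets borel"
  shows "measure M {\<omega> \<in> space M. \<forall>i\<in>I. Y i \<omega> \<in> A i} = measure N {\<omega> \<in> space N. \<forall>i\<in>I. Z i \<omega> \<in> A i}"
proof -
  interpret M: prob_space M by fact
  interpret N: prob_space N by fact
  define F where "F J \<omega> = (\<Prod>j\<in>J. indicator (A j) (Y j \<omega>) :: real)" for J \<omega>
  define G where "G J \<omega> = (\<Prod>j\<in>J. indicator (A j) (Z j \<omega>) :: real)" for J \<omega>
  define S where "S a \<omega> = (\<Sum>i\<in>I. a i * Y i \<omega>)" for a \<omega>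
  define T where "T a \<omega> = (\<Sum>i\<in>I. a i * Z i \<omega>)" for a \<omega>
  have [measurable]: "S a \<in> borel_measurable M" "T a \<in> borel_measurable N" for a
    unfolding S_def T_def using Y Z by measurable
  have F_meas: "F J \<in> borel_measurable M" and G_meas: "G J \<in> borel_measurable N" if "J \<subseteq> I" for J
  proof -
    have J: "finite J" "\<And>j. j \<in> J \<Longrightarrow> j \<in> I" using that I finite_subset by auto
    have "(\<lambda>\<omega>. indicator (A j) (Y j \<omega>) :: real) \<in> borel_measurable M" 
      "(\<lambda>\<omega>. indicator (A j) (Z j \<omega>) :: real) \<in> borel_measurable N" if "j \<in> J" for j
    proof -
      note [measurable] = Y[OF J(2)[OF that]] Z[OF J(2)[OF that]] A[OF J(2)[OF that]]
      show "(\<lambda>\<omega>. indicator (A j) (Y j \<omega>) :: real) \<in> borel_measurable M" 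
      "(\<lambda>\<omega>. indicator (A j) (Z j \<omega>) :: real) \<in> borel_measurable N" by measurable
    qed
    then show "F J \<in> borel_measurable M" "G J \<in> borel_measurable N"
      unfolding F_def G_def by (auto intro!: borel_measurable_prod)
  qed
  have FG_bounds: "0 \<le> F J \<omega>" "F J \<omega> \<le> 1" "0 \<le> G J \<omega>'" "G J \<omega>' \<le> 1" for J \<omega> \<omega>'
    unfolding F_def G_def by (auto intro!: prod_nonneg prod_le_1)
  have int: "integrable M (\<lambda>\<omega>. complex_of_real (F J \<omega>) * iexp (S a \<omega>))"
    "integrable N (\<lambda>\<omega>. complex_of_real (G J \<omega>) * iexp (T a \<omega>))" if "J \<subseteq> I" for J a
  proof -
    note [measurable] = F_meas[OF that] G_meas[OF that]
    show "integrable M (\<lambda>\<omega>. complex_of_real (F J \<omega>) * iexp (S a \<omega>))"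
      by (rule M.integrable_const_bound[of _ 1]) (use FG_bounds in \<open>auto simp: norm_mult\<close>)
    show "integrable N (\<lambda>\<omega>. complex_of_real (G J \<omega>) * iexp (T a \<omega>))"
      by (rule N.integrable_const_bound[of _ 1]) (use FG_bounds in \<open>auto simp: norm_mult\<close>)
  qed
  have "(CLINT \<omega>|M. complex_of_real (F J \<omega>) * iexp (S a \<omega>)) =
      (CLINT \<omega>|N. complex_of_real (G J \<omega>) * iexp (T a \<omega>))" if "J \<subseteq> I" for J a
    using finite_subset[OF that I] that
  proof (induction J arbitrary: a rule: finite_induct)
    case empty
    then show ?case using char_eq[of a] by (simp add: F_def G_def S_def T_def)
  next
    case (insert j J)
    then have J: "J \<subseteq> I" and j: "j \<in> I" "j \<notin> J" "finite J" by auto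
    note IH = insert.IH[OF J]
    note [measurable] = F_meas[OF J] G_meas[OF J] Y[OF j(1)] Z[OF j(1)] A[OF j(1)]
    have shift: "(\<Sum>i\<in>I. (r * a i + (if i = j then t else 0)) * y i) = r * (\<Sum>i\<in>I. a i * y i) + t * y j"
      for r t a and y :: "'i \<Rightarrow> real"
    proof -
      have "(\<Sum>i\<in>I. (r * a i + (if i = j then t else 0)) * y i) =
        (\<Sum>i\<in>I. r * (a i * y i)) + (\<Sum>i\<in>I. if i = j then t * y i else 0)"
        unfolding sum.distrib[symmetric] by (rule sum.cong) (auto simp: algebra_simps)
      then show ?thesis using I j by (simp add: sum_distrib_left)
    qed
    note S_shift = shift[of _ _ _ "\<lambda>i. Y i _", folded S_def]
    note T_shift = shift[of _ _ _ "\<lambda>i. Z i _", folded T_def]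
    have shift_eq: "(CLINT \<omega>|M. complex_of_real (F J \<omega>) * iexp (r * S a \<omega> + t * Y j \<omega>)) =
      (CLINT \<omega>|N. complex_of_real (G J \<omega>) * iexp (r * T a \<omega> + t * Z j \<omega>))" for r t a
      using IH[of "\<lambda>i. r * a i + (if i = j then t else 0)"] by (simp only: S_shift T_shift)
    have shift_int: "integrable M (\<lambda>\<omega>. complex_of_real (F J \<omega>) * iexp (r * S a \<omega> + t * Y j \<omega>))"
      "integrable N (\<lambda>\<omega>. complex_of_real (G J \<omega>) * iexp (r * T a \<omega> + t * Z j \<omega>))" for r t a
      using int[OF J, of "\<lambda>i. r * a i + (if i = j then t else 0)"] by (simp_all only: S_shift T_shift)
    have tilt: "complex_of_real (x * (1 + cos (s + p))) * iexp y = complex_of_real x * iexp (0 * s + y)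
        + (iexp p * (complex_of_real x * iexp (1 * s + y))
          + iexp (- p) * (complex_of_real x * iexp (- 1 * s + y))) / 2" for x s p y
    proof -
      have "complex_of_real (cos (s + p)) = (iexp (s + p) + iexp (- (s + p))) / 2"
        by (simp add: cos_of_real[symmetric] cos_exp_eq algebra_simps del: cos_of_real)
      moreover have "iexp (0 * s + y) = iexp y"
        "iexp p * iexp (1 * s + y) = iexp (s + p) * iexp y"
        "iexp (- p) * iexp (- 1 * s + y) = iexp (- (s + p)) * iexp y"
        by (simp_all add: exp_add[symmetric] algebra_simps)
      ultimately show ?thesis
        by (simp only: mult.left_commute[of _ "complex_of_real x"] of_real_mult of_real_add) (simp add: field_simps)
    qed
    have cosine: "(\<integral>\<omega>. F J \<omega> * (1 + cos (S a \<omega> + p)) * indicator (A j) (Y j \<omega>) \<partial>M) =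
      (\<integral>\<omega>. G J \<omega> * (1 + cos (T a \<omega> + p)) * indicator (A j) (Z j \<omega>) \<partial>N)" for a p
    proof (rule weighted_law_unique[where c = 2, OF M _ _ _ _ N])
      have c: "0 \<le> 1 + cos x" "1 + cos x \<le> 2" for x :: real
        using cos_ge_minus_one[of x] cos_le_one[of x] by linarith+
      show "0 \<le> F J \<omega> * (1 + cos (S a \<omega> + p))" "0 \<le> G J \<omega>' * (1 + cos (T a \<omega>' + p))" for \<omega> \<omega>'
        by (intro mult_nonneg_nonneg FG_bounds c)+
      show "F J \<omega> * (1 + cos (S a \<omega> + p)) \<le> 2" "G J \<omega>' * (1 + cos (T a \<omega>' + p)) \<le> 2" for \<omega> \<omega>'
        using mult_mono[OF FG_bounds(2) c(2) _ c(1)] mult_mono[OF FG_bounds(4) c(2) _ c(1)] by simp_all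
      show "(CLINT \<omega>|M. complex_of_real (F J \<omega> * (1 + cos (S a \<omega> + p))) * iexp (t * Y j \<omega>)) =
        (CLINT \<omega>|N. complex_of_real (G J \<omega> * (1 + cos (T a \<omega> + p))) * iexp (t * Z j \<omega>))" for t
        unfolding tilt integral_combination[OF shift_int(1) shift_int(1) shift_int(1)]
          integral_combination[OF shift_int(2) shift_int(2) shift_int(2)] by (simp only: shift_eq)
    qed measurable
    have bint: "integrable M (\<lambda>\<omega>. F J \<omega> * h (S a \<omega>) * indicator (A j) (Y j \<omega>))"
      "integrable N (\<lambda>\<omega>. G J \<omega> * h (T a \<omega>) * indicator (A j) (Z j \<omega>))" 
      if [measurable]: "h \<in> borel_measurable borel" and h: "\<And>x. \<bar>h x\<bar> \<le> 1" for h a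
      by (rule M.integrable_const_bound[of _ 1] N.integrable_const_bound[of _ 1],
        use FG_bounds h in \<open>auto simp: abs_mult indicator_def intro!: mult_le_one\<close>)+
    \<comment> \<open>With \<open>a = 0\<close> and \<open>p = 0\<close> the weight \<open>1 + cos\<close> is the constant 2, which isolates the summand 1.\<close>
    have plain: "(\<integral>\<omega>. F J \<omega> * indicator (A j) (Y j \<omega>) \<partial>M) = (\<integral>\<omega>. G J \<omega> * indicator (A j) (Z j \<omega>) \<partial>N)"
      using cosine[of "\<lambda>_. 0" 0] by (simp add: S_def T_def mult.assoc[of _ 2] mult.left_commute[of _ 2])
    have cos_eq: "(\<integral>\<omega>. F J \<omega> * cos (S a \<omega> + p) * indicator (A j) (Y j \<omega>) \<partial>M) =
      (\<integral>\<omega>. G J \<omega> * cos (T a \<omega> + p) * indicator (A j) (Z j \<omega>) \<partial>N)" for a p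
      using cosine[of a p] plain bint[of "\<lambda>x. cos (x + p)" a] bint[of "\<lambda>x. 1" a]
      by (simp add: distrib_left distrib_right)
    have split: "complex_of_real (x * i) * iexp s =
      complex_of_real (x * cos (s + 0) * i) + \<i> * complex_of_real (x * cos (s + - (pi / 2)) * i)" for x i s
      by (simp add: exp_Euler cos_of_real sin_of_real cos_diff algebra_simps)
    have F_insert: "F (insert j J) \<omega> = F J \<omega> * indicator (A j) (Y j \<omega>)"
      and G_insert: "G (insert j J) \<omega>' = G J \<omega>' * indicator (A j) (Z j \<omega>')" for \<omega> \<omega>'
      using j by (simp_all add: F_def G_def mult.commute)
    have insert_split: "complex_of_real (F (insert j J) \<omega>) * iexp (S a \<omega>) =
      complex_of_real (F J \<omega> * cos (S a \<omega> + 0) * indicator (A j) (Y j \<omega>)) +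
      \<i> * complex_of_real (F J \<omega> * cos (S a \<omega> + - (pi / 2)) * indicator (A j) (Y j \<omega>))"
      "complex_of_real (G (insert j J) \<omega>') * iexp (T a \<omega>') =
      complex_of_real (G J \<omega>' * cos (T a \<omega>' + 0) * indicator (A j) (Z j \<omega>')) +
      \<i> * complex_of_real (G J \<omega>' * cos (T a \<omega>' + - (pi / 2)) * indicator (A j) (Z j \<omega>'))" for \<omega> \<omega>'
      using j by (simp_all only: F_insert G_insert split)
    have cint: "complex_integrable M (\<lambda>\<omega>. complex_of_real (F J \<omega> * cos (S a \<omega> + p) * indicator (A j) (Y j \<omega>)))"
      "complex_integrable N (\<lambda>\<omega>. complex_of_real (G J \<omega> * cos (T a \<omega> + p) * indicator (A j) (Z j \<omega>)))" for p
      using bint[of "\<lambda>x. cos (x + p)" a] by (simp_all only: complex_of_real_integrable_eq) simp_all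
    show ?case
      unfolding insert_split
      by (simp only: Bochner_Integration.integral_add integrable_mult_right cint
        integral_mult_right_zero integral_complex_of_real cos_eq)
  qed
  from this[of I "\<lambda>_. 0"] have "(\<integral>\<omega>. F I \<omega> \<partial>M) = (\<integral>\<omega>. G I \<omega> \<partial>N)"
    by (simp add: S_def T_def integral_complex_of_real)
  moreover have "F I \<omega> = indicator {\<omega>. \<forall>i\<in>I. Y i \<omega> \<in> A i} \<omega>" "G I \<omega>' = indicator {\<omega>. \<forall>i\<in>I. Z i \<omega> \<in> A i} \<omega>'" for \<omega> \<omega>'
    using I unfolding F_def G_def by (auto simp: indicator_def)
  ultimately show ?thesis
    by (simp add: Collect_conj_eq Int_commute)
qed

section \<open>Centred Gauss fields and their covariance\<close>

text \<open>
  \<open>K\<close> is the covariance function. The last clause states that every finite linear combination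
  is a centred normal variable with the variance that \<open>K\<close> prescribes. In this form the notion is
  visibly stable under linear images of the field, and it fixes all characteristic functions.
\<close>

definition centered_gaussian ::
  "'a measure \<Rightarrow> 'i set \<Rightarrow> ('i \<Rightarrow> 'a \<Rightarrow> real) \<Rightarrow> ('i \<Rightarrow> 'i \<Rightarrow> real) \<Rightarrow> bool"
  where "centered_gaussian M D Y K \<longleftrightarrow>
    prob_space M \<and> (\<forall>i\<in>D. Y i \<in> borel_measurable M) \<and>
    (\<forall>I a. finite I \<and> I \<subseteq> D \<longrightarrow>
      (\<exists>\<sigma>\<ge>0. \<sigma>\<^sup>2 = (\<Sum>i\<in>I. \<Sum>j\<in>I. a i * a j * K i j) \<and>
        distr M borel (\<lambda>\<omega>. \<Sum>i\<in>I. a i * Y i \<omega>) = normal_law 0 \<sigma>))"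

lemma centered_gaussianE:
  assumes "centered_gaussian M D Y K" "finite I" "I \<subseteq> D"
  obtains \<sigma> where "0 \<le> \<sigma>" "\<sigma>\<^sup>2 = (\<Sum>i\<in>I. \<Sum>j\<in>I. a i * a j * K i j)"
    "distr M borel (\<lambda>\<omega>. \<Sum>i\<in>I. a i * Y i \<omega>) = normal_law 0 \<sigma>"
  using assms unfolding centered_gaussian_def by blast

lemma normal_law_moments:
  assumes "0 \<le> \<sigma>"
  shows "integrable (normal_law \<mu> \<sigma>) (\<lambda>x. x)" "(\<integral>x. x \<partial>normal_law \<mu> \<sigma>) = \<mu>"
    and "integrable (normal_law 0 \<sigma>) (\<lambda>x. x\<^sup>2)" "(\<integral>x. x\<^sup>2 \<partial>normal_law 0 \<sigma>) = \<sigma>\<^sup>2"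
proof -
  consider "\<sigma> = 0" | "0 < \<sigma>" using assms by fastforce
  then have "integrable (normal_law \<mu> \<sigma>) (\<lambda>x. x) \<and> (\<integral>x. x \<partial>normal_law \<mu> \<sigma>) = \<mu> \<and>
    integrable (normal_law 0 \<sigma>) (\<lambda>x. x\<^sup>2) \<and> (\<integral>x. x\<^sup>2 \<partial>normal_law 0 \<sigma>) = \<sigma>\<^sup>2"
  proof cases
    case 1
    have dirac: "integrable (return borel m) f" if "f \<in> borel_measurable borel" for m and f :: "real \<Rightarrow> real"
      by (rule integrableI_bounded) (use that in \<open>simp_all add: nn_integral_return\<close>)
    show ?thesis
      using 1 by (simp add: normal_law_def integral_return dirac)
  next
    case 2
    then show ?thesis
      using integrable_normal_moment_nz_1[OF 2, of \<mu>] integral_normal_moment_nz_1[OF 2, of \<mu>]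
        integrable_normal_moment[OF 2, of 0 2] integral_normal_moment_even[OF 2, of 0 1]
      by (auto simp: normal_law_def integrable_density integral_density fact_numeral field_simps power2_eq_square)
  qed
  then show "integrable (normal_law \<mu> \<sigma>) (\<lambda>x. x)" "(\<integral>x. x \<partial>normal_law \<mu> \<sigma>) = \<mu>"
    "integrable (normal_law 0 \<sigma>) (\<lambda>x. x\<^sup>2)" "(\<integral>x. x\<^sup>2 \<partial>normal_law 0 \<sigma>) = \<sigma>\<^sup>2"
    by auto
qed

lemma gauss_field_normal_combination:
  assumes Y: "gauss_field M D Y" and I: "finite I" "I \<subseteq> D"
  obtains \<mu> \<sigma> where "0 \<le> \<sigma>" "distr M borel (\<lambda>\<omega>. \<Sum>i\<in>I. a i * Y i \<omega>) = normal_law \<mu> \<sigma>"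
proof -
  have [measurable]: "Y i \<in> borel_measurable M" if "i \<in> I" for i
    using Y I that by (auto simp: gauss_field_def random_field_def)
  have "multivariate_normal I (distr M (Pi\<^sub>M I (\<lambda>_. borel)) (\<lambda>\<omega>. \<lambda>z\<in>I. Y z \<omega>))"
    using Y I by (simp add: gauss_field_def)
  then obtain \<mu> \<sigma> where "0 \<le> \<sigma>" and
    eq: "distr (distr M (Pi\<^sub>M I (\<lambda>_. borel)) (\<lambda>\<omega>. \<lambda>z\<in>I. Y z \<omega>)) borel (\<lambda>x. \<Sum>i\<in>I. a i * x i) = normal_law \<mu> \<sigma>"
    unfolding multivariate_normal_def by blast
  have "distr (distr M (Pi\<^sub>M I (\<lambda>_. borel)) (\<lambda>\<omega>. \<lambda>z\<in>I. Y z \<omega>)) borel (\<lambda>x. \<Sum>i\<in>I. a i * x i) =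
    distr M borel (\<lambda>\<omega>. \<Sum>i\<in>I. a i * Y i \<omega>)"
    by (subst distr_distr) (auto simp: comp_def intro!: measurable_restrict)
  with eq \<open>0 \<le> \<sigma>\<close> that show ?thesis by metis
qed

lemma centered_gaussian_imp_gauss_field:
  assumes Y: "centered_gaussian M D Y K"
  shows "gauss_field M D Y"
  unfolding gauss_field_def random_field_def multivariate_normal_def
proof (intro conjI allI impI)
  show "prob_space M" "\<forall>z\<in>D. Y z \<in> borel_measurable M"
    using Y by (auto simp: centered_gaussian_def)
  fix I and a :: "real \<times> real \<Rightarrow> real" assume I: "finite I \<and> I \<subseteq> D"
  then show "finite I" by simp
  have [measurable]: "Y i \<in> borel_measurable M" if "i \<in> I" for i
    using Y I that by (auto simp: centered_gaussian_def)
  have "distr (distr M (Pi\<^sub>M I (\<lambda>_. borel)) (\<lambda>\<omega>. \<lambda>z\<in>I. Y z \<omega>)) borel (\<lambda>x. \<Sum>i\<in>I. a i * x i) =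
    distr M borel (\<lambda>\<omega>. \<Sum>i\<in>I. a i * Y i \<omega>)"
    by (subst distr_distr) (auto simp: comp_def intro!: measurable_restrict)
  moreover obtain \<sigma> where "0 \<le> \<sigma>" "distr M borel (\<lambda>\<omega>. \<Sum>i\<in>I. a i * Y i \<omega>) = normal_law 0 \<sigma>"
    using I by (auto elim: centered_gaussianE[OF Y])
  ultimately show "\<exists>\<mu> \<sigma>. 0 \<le> \<sigma> \<and> distr (distr M (Pi\<^sub>M I (\<lambda>_. borel)) (\<lambda>\<omega>. \<lambda>z\<in>I. Y z \<omega>)) borel
    (\<lambda>x. \<Sum>i\<in>I. a i * x i) = normal_law \<mu> \<sigma>" by metis
qed simp

text \<open>
  A linear combination is normal by assumption, so only its mean and variance have to be found. Each
  single coordinate is normal, hence square integrable, and mean and variance may be expanded by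
  bilinearity.
\<close>

lemma gauss_field_imp_centered_gaussian:
  assumes Y: "gauss_field M D Y"
    and mean: "\<And>z. z \<in> D \<Longrightarrow> integral\<^sup>L M (Y z) = 0"
    and cov: "\<And>z z'. z \<in> D \<Longrightarrow> z' \<in> D \<Longrightarrow> covariance M (Y z) (Y z') = K z z'"
  shows "centered_gaussian M D Y K"
  unfolding centered_gaussian_def
proof (intro conjI allI impI)
  show "prob_space M" and Y_meas: "\<forall>z\<in>D. Y z \<in> borel_measurable M"
    using Y by (auto simp: gauss_field_def random_field_def)
  have integrable_Y: "integrable M (Y z)" and square_integrable_Y: "integrable M (\<lambda>\<omega>. (Y z \<omega>)\<^sup>2)" if z: "z \<in> D" for z
  proof -
    have [measurable]: "Y z \<in> borel_measurable M" using Y_meas z by simp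
    obtain \<mu> \<sigma> where \<sigma>: "0 \<le> \<sigma>" and "distr M borel (\<lambda>\<omega>. \<Sum>i\<in>{z}. 1 * Y i \<omega>) = normal_law \<mu> \<sigma>"
      by (rule gauss_field_normal_combination[OF Y, of "{z}" "\<lambda>_. 1"]) (use z in auto)
    then have law: "distr M borel (Y z) = normal_law \<mu> \<sigma>" by simp
    show int: "integrable M (Y z)"
      using normal_law_moments(1)[OF \<sigma>, of \<mu>] by (simp add: law[symmetric] integrable_distr_eq)
    have \<mu>: "\<mu> = 0"
      using normal_law_moments(2)[OF \<sigma>, of \<mu>] mean[OF z] by (simp add: law[symmetric] integral_distr)
    show "integrable M (\<lambda>\<omega>. (Y z \<omega>)\<^sup>2)"
      using normal_law_moments(3)[OF \<sigma>] by (simp add: law[unfolded \<mu>, symmetric] integrable_distr_eq)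
  qed
  have integrable_product: "integrable M (\<lambda>\<omega>. Y z \<omega> * Y z' \<omega>)" if "z \<in> D" "z' \<in> D" for z z'
  proof (rule Bochner_Integration.integrable_bound)
    show "integrable M (\<lambda>\<omega>. (Y z \<omega>)\<^sup>2 + (Y z' \<omega>)\<^sup>2)"
      using square_integrable_Y that by simp
    show "(\<lambda>\<omega>. Y z \<omega> * Y z' \<omega>) \<in> borel_measurable M"
      using Y_meas that by (intro borel_measurable_times) auto
    have "\<bar>x * y\<bar> \<le> x\<^sup>2 + y\<^sup>2" for x y :: real
      using sum_squares_bound[of "\<bar>x\<bar>" "\<bar>y\<bar>"] mult_nonneg_nonneg[of "\<bar>x\<bar>" "\<bar>y\<bar>"]
      unfolding abs_mult power2_abs by linarith
    then show "AE \<omega> in M. norm (Y z \<omega> * Y z' \<omega>) \<le> norm ((Y z \<omega>)\<^sup>2 + (Y z' \<omega>)\<^sup>2)" by simp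
  qed
  have expectation_product: "(\<integral>\<omega>. Y z \<omega> * Y z' \<omega> \<partial>M) = K z z'" if "z \<in> D" "z' \<in> D" for z z'
    using cov[OF that] mean that by (simp add: covariance_def)
  fix I and a :: "real \<times> real \<Rightarrow> real" assume "finite I \<and> I \<subseteq> D"
  then have I: "finite I" "I \<subseteq> D" by auto
  let ?S = "\<lambda>\<omega>. \<Sum>i\<in>I. a i * Y i \<omega>"
  have [measurable]: "?S \<in> borel_measurable M"
    using Y_meas I by (intro borel_measurable_sum borel_measurable_times) auto
  obtain \<mu> \<sigma> where \<sigma>: "0 \<le> \<sigma>" and law: "distr M borel ?S = normal_law \<mu> \<sigma>"
    using gauss_field_normal_combination[OF Y I] by metis
  have "\<mu> = (\<integral>\<omega>. ?S \<omega> \<partial>M)"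
    using normal_law_moments(2)[OF \<sigma>, of \<mu>] by (simp add: law[symmetric] integral_distr)
  also have "\<dots> = (\<Sum>i\<in>I. a i * integral\<^sup>L M (Y i))"
    using integrable_Y I by (subst Bochner_Integration.integral_sum) auto
  also have "\<dots> = 0" using mean I by (auto intro!: sum.neutral)
  finally have \<mu>: "\<mu> = 0" .
  have "\<sigma>\<^sup>2 = (\<integral>\<omega>. (?S \<omega>)\<^sup>2 \<partial>M)"
    using normal_law_moments(4)[OF \<sigma>] by (simp add: law[unfolded \<mu>, symmetric] integral_distr)
  also have "\<dots> = (\<integral>\<omega>. (\<Sum>i\<in>I. \<Sum>j\<in>I. a i * a j * (Y i \<omega> * Y j \<omega>)) \<partial>M)"
    by (simp add: power2_eq_square sum_product ac_simps)
  also have "\<dots> = (\<Sum>i\<in>I. \<integral>\<omega>. (\<Sum>j\<in>I. a i * a j * (Y i \<omega> * Y j \<omega>)) \<partial>M)"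
    using I(2) by (intro Bochner_Integration.integral_sum Bochner_Integration.integrable_sum
        integrable_mult_right integrable_product) auto
  also have "\<dots> = (\<Sum>i\<in>I. \<Sum>j\<in>I. \<integral>\<omega>. a i * a j * (Y i \<omega> * Y j \<omega>) \<partial>M)"
    using I(2) by (intro sum.cong refl Bochner_Integration.integral_sum
        integrable_mult_right integrable_product) auto
  also have "\<dots> = (\<Sum>i\<in>I. \<Sum>j\<in>I. a i * a j * (\<integral>\<omega>. Y i \<omega> * Y j \<omega> \<partial>M))"
    by simp
  also have "\<dots> = (\<Sum>i\<in>I. \<Sum>j\<in>I. a i * a j * K i j)"
    by (intro sum.cong refl) (simp add: expectation_product subsetD[OF I(2)])
  finally show "\<exists>\<sigma>\<ge>0. \<sigma>\<^sup>2 = (\<Sum>i\<in>I. \<Sum>j\<in>I. a i * a j * K i j) \<and> distr M borel ?S = normal_law 0 \<sigma>"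
    using \<sigma> law \<mu> by blast
qed

text \<open>
  Collects the terms of a sum that refer to the same point \<open>d\<close>. This is needed because a linear image
  may use one point of the original field several times.
\<close>

lemma sum_over_fibres:
  fixes b :: "'q \<Rightarrow> real"
  assumes "finite T"
  shows "(\<Sum>d\<in>p ` T. (\<Sum>q\<in>{q \<in> T. p q = d}. b q) * F d) = (\<Sum>q\<in>T. b q * F (p q))"
proof -
  have "(\<Sum>q\<in>T. b q * F (p q)) = (\<Sum>d\<in>p ` T. \<Sum>q\<in>{q \<in> T. p q = d}. b q * F (p q))"
    by (rule sum.image_gen[OF assms])
  also have "\<dots> = (\<Sum>d\<in>p ` T. (\<Sum>q\<in>{q \<in> T. p q = d}. b q) * F d)"
    by (auto simp: sum_distrib_right intro!: sum.cong)
  finally show ?thesis by simp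
qed

text \<open>
  All fields of this development are of the form \<open>Z z = \<Sum>j. c z j \<cdot> Y (p z j)\<close> with \<open>Y\<close> a Wiener field,
  so a combination of values of \<open>Z\<close> is a combination of values of \<open>Y\<close>. Since \<open>p\<close> may fail to be
  injective, coefficients at equal points are added up first.
\<close>

lemma centered_gaussian_linear_image:
  fixes Y :: "'i \<Rightarrow> 'a \<Rightarrow> real" and Z :: "'k \<Rightarrow> 'a \<Rightarrow> real" and p :: "'k \<Rightarrow> 'j \<Rightarrow> 'i"
  assumes Y: "centered_gaussian M D Y K" and J: "finite J"
    and p: "\<And>z j. z \<in> D' \<Longrightarrow> j \<in> J \<Longrightarrow> p z j \<in> D"
    and Z: "\<And>z \<omega>. z \<in> D' \<Longrightarrow> \<omega> \<in> space M \<Longrightarrow> Z z \<omega> = (\<Sum>j\<in>J. c z j * Y (p z j) \<omega>)"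
    and K': "\<And>z z'. z \<in> D' \<Longrightarrow> z' \<in> D' \<Longrightarrow>
      K' z z' = (\<Sum>j\<in>J. \<Sum>j'\<in>J. c z j * c z' j' * K (p z j) (p z' j'))"
  shows "centered_gaussian M D' Z K'"
  unfolding centered_gaussian_def
proof (intro conjI allI impI ballI)
  show "prob_space M" using Y by (simp add: centered_gaussian_def)
  show "Z z \<in> borel_measurable M" if z: "z \<in> D'" for z
  proof (subst measurable_cong)
    show "Z z \<omega> = (\<Sum>j\<in>J. c z j * Y (p z j) \<omega>)" if "\<omega> \<in> space M" for \<omega>
      by (rule Z[OF z that])
    show "(\<lambda>\<omega>. \<Sum>j\<in>J. c z j * Y (p z j) \<omega>) \<in> borel_measurable M"
      using Y p[OF z] by (intro borel_measurable_sum borel_measurable_times) (auto simp: centered_gaussian_def)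
  qed
  fix I and a :: "'k \<Rightarrow> real" assume "finite I \<and> I \<subseteq> D'"
  then have I: "finite I" "I \<subseteq> D'" by auto
  define T where "T = I \<times> J"
  define b where "b q = a (fst q) * c (fst q) (snd q)" for q
  define P where "P q = p (fst q) (snd q)" for q
  define a' where "a' d = (\<Sum>q\<in>{q \<in> T. P q = d}. b q)" for d
  have T: "finite T" using I J by (simp add: T_def)
  have P: "finite (P ` T)" "P ` T \<subseteq> D"
    using T p I by (auto simp: T_def P_def)
  have sum_T: "(\<Sum>q\<in>T. g q) = (\<Sum>i\<in>I. \<Sum>j\<in>J. g (i, j))" for g :: "'k \<times> 'j \<Rightarrow> real"
    by (simp add: T_def sum.cartesian_product case_prod_beta)
  note fibres = sum_over_fibres[where p = P and b = b, OF T, folded a'_def]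
  obtain \<sigma> where \<sigma>: "0 \<le> \<sigma>" "\<sigma>\<^sup>2 = (\<Sum>d\<in>P ` T. \<Sum>d'\<in>P ` T. a' d * a' d' * K d d')"
    "distr M borel (\<lambda>\<omega>. \<Sum>d\<in>P ` T. a' d * Y d \<omega>) = normal_law 0 \<sigma>"
    by (rule centered_gaussianE[OF Y P])
  have "(\<Sum>i\<in>I. a i * Z i \<omega>) = (\<Sum>d\<in>P ` T. a' d * Y d \<omega>)" if "\<omega> \<in> space M" for \<omega>
  proof -
    have "(\<Sum>i\<in>I. a i * Z i \<omega>) = (\<Sum>i\<in>I. \<Sum>j\<in>J. a i * c i j * Y (p i j) \<omega>)"
      using I Z that by (auto simp: sum_distrib_left mult.assoc intro!: sum.cong)
    also have "\<dots> = (\<Sum>q\<in>T. b q * Y (P q) \<omega>)"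
      by (simp add: sum_T b_def P_def)
    finally show ?thesis by (simp add: fibres)
  qed
  then have "distr M borel (\<lambda>\<omega>. \<Sum>i\<in>I. a i * Z i \<omega>) = normal_law 0 \<sigma>"
    unfolding \<sigma>(3)[symmetric] by (intro distr_cong) auto
  moreover have "(\<Sum>i\<in>I. \<Sum>i'\<in>I. a i * a i' * K' i i') = \<sigma>\<^sup>2"
  proof -
    have "(\<Sum>i\<in>I. \<Sum>i'\<in>I. a i * a i' * K' i i') =
      (\<Sum>i\<in>I. \<Sum>i'\<in>I. \<Sum>j\<in>J. \<Sum>j'\<in>J. a i * c i j * (a i' * c i' j' * K (p i j) (p i' j')))"
      using I by (intro sum.cong refl) (auto simp: K' subset_iff sum_distrib_left ac_simps)
    also have "\<dots> = (\<Sum>i\<in>I. \<Sum>j\<in>J. \<Sum>i'\<in>I. \<Sum>j'\<in>J. a i * c i j * (a i' * c i' j' * K (p i j) (p i' j')))"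
      by (intro sum.cong refl sum.swap)
    also have "\<dots> = (\<Sum>q\<in>T. \<Sum>q'\<in>T. b q * (b q' * K (P q) (P q')))"
      by (simp add: sum_T b_def P_def)
    also have "\<dots> = (\<Sum>d\<in>P ` T. a' d * (\<Sum>d'\<in>P ` T. a' d' * K d d'))"
      by (simp only: fibres sum_distrib_left[symmetric])
    also have "\<dots> = \<sigma>\<^sup>2"
      unfolding \<sigma>(2) by (simp add: sum_distrib_left mult.assoc)
    finally show ?thesis .
  qed
  ultimately show "\<exists>\<sigma>\<ge>0. \<sigma>\<^sup>2 = (\<Sum>i\<in>I. \<Sum>i'\<in>I. a i * a i' * K' i i') \<and>
    distr M borel (\<lambda>\<omega>. \<Sum>i\<in>I. a i * Z i \<omega>) = normal_law 0 \<sigma>"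
    using \<sigma>(1) by metis
qed

text \<open>
  Equal covariances give equal characteristic functions of all finite subfamilies, hence equal
  probabilities of cylinder sets, and these generate the product \<open>\<sigma>\<close>-algebra.
\<close>

theorem centered_gaussian_law_unique:
  fixes Y :: "'i \<Rightarrow> 'a \<Rightarrow> real" and Z :: "'i \<Rightarrow> 'b \<Rightarrow> real"
  assumes Y: "centered_gaussian M D Y K" and Z: "centered_gaussian N D Z K" and Q: "Q \<subseteq> D"
  shows "distr M (Pi\<^sub>M Q (\<lambda>_. borel)) (\<lambda>\<omega>. \<lambda>i\<in>Q. Y i \<omega>) =
    distr N (Pi\<^sub>M Q (\<lambda>_. borel)) (\<lambda>\<omega>. \<lambda>i\<in>Q. Z i \<omega>)"
proof (rule measure_eqI_PiM_infinite)
  interpret M: prob_space M using Y by (simp add: centered_gaussian_def)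
  interpret N: prob_space N using Z by (simp add: centered_gaussian_def)
  have Y_meas: "Y i \<in> borel_measurable M" and Z_meas: "Z i \<in> borel_measurable N" if "i \<in> D" for i
    using Y Z that by (auto simp: centered_gaussian_def)
  have paths: "(\<lambda>\<omega>. \<lambda>i\<in>Q. Y i \<omega>) \<in> M \<rightarrow>\<^sub>M Pi\<^sub>M Q (\<lambda>_. borel)" "(\<lambda>\<omega>. \<lambda>i\<in>Q. Z i \<omega>) \<in> N \<rightarrow>\<^sub>M Pi\<^sub>M Q (\<lambda>_. borel)"
    using Y_meas Z_meas Q by (auto intro!: measurable_restrict)
  show "finite_measure (distr M (Pi\<^sub>M Q (\<lambda>_. borel)) (\<lambda>\<omega>. \<lambda>i\<in>Q. Y i \<omega>))"
    using M.prob_space_distr[OF paths(1)] by (simp add: prob_space_def)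
  fix A and J assume J: "finite J" "J \<subseteq> Q" and A: "\<And>i. i \<in> J \<Longrightarrow> A i \<in> sets (borel :: real measure)"
  have char_eq: "(CLINT \<omega>|M. iexp (\<Sum>i\<in>J. a i * Y i \<omega>)) = (CLINT \<omega>|N. iexp (\<Sum>i\<in>J. a i * Z i \<omega>))" for a
  proof -
    have J': "finite J" "J \<subseteq> D" using J Q by auto
    obtain \<sigma> where \<sigma>: "0 \<le> \<sigma>" "\<sigma>\<^sup>2 = (\<Sum>i\<in>J. \<Sum>j\<in>J. a i * a j * K i j)"
      "distr M borel (\<lambda>\<omega>. \<Sum>i\<in>J. a i * Y i \<omega>) = normal_law 0 \<sigma>"
      by (rule centered_gaussianE[OF Y J'])
    obtain \<tau> where \<tau>: "0 \<le> \<tau>" "\<tau>\<^sup>2 = (\<Sum>i\<in>J. \<Sum>j\<in>J. a i * a j * K i j)"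
      "distr N borel (\<lambda>\<omega>. \<Sum>i\<in>J. a i * Z i \<omega>) = normal_law 0 \<tau>"
      by (rule centered_gaussianE[OF Z J'])
    have "\<sigma> = \<tau>" using \<sigma>(1,2) \<tau>(1,2) power2_eq_iff_nonneg[of \<sigma> \<tau>] by metis
    then have "(CLINT x|distr M borel (\<lambda>\<omega>. \<Sum>i\<in>J. a i * Y i \<omega>). iexp x) =
      (CLINT x|distr N borel (\<lambda>\<omega>. \<Sum>i\<in>J. a i * Z i \<omega>). iexp x)" 
      by (simp only: \<sigma>(3) \<tau>(3))
    moreover have "(\<lambda>\<omega>. \<Sum>i\<in>J. a i * Y i \<omega>) \<in> borel_measurable M" "(\<lambda>\<omega>. \<Sum>i\<in>J. a i * Z i \<omega>) \<in> borel_measurable N"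
      using Y_meas Z_meas J' by (auto intro!: borel_measurable_sum)
    ultimately show ?thesis by (simp add: integral_distr)
  qed
  have "measure M {\<omega> \<in> space M. \<forall>i\<in>J. Y i \<omega> \<in> A i} = measure N {\<omega> \<in> space N. \<forall>i\<in>J. Z i \<omega> \<in> A i}"
    by (rule joint_law_determined_by_characteristic_function[OF M.prob_space_axioms N.prob_space_axioms J(1)])
      (use Y_meas Z_meas J Q A char_eq in auto)
  moreover have "prod_emb Q (\<lambda>_. borel) J (Pi\<^sub>E J A) \<in> sets (Pi\<^sub>M Q (\<lambda>_. borel))"
    using J A by (intro sets_PiM_I) auto
  moreover have "(\<lambda>\<omega>. \<lambda>i\<in>Q. Y i \<omega>) -` prod_emb Q (\<lambda>_. borel) J (Pi\<^sub>E J A) \<inter> space M = {\<omega> \<in> space M. \<forall>i\<in>J. Y i \<omega> \<in> A i}"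
    "(\<lambda>\<omega>. \<lambda>i\<in>Q. Z i \<omega>) -` prod_emb Q (\<lambda>_. borel) J (Pi\<^sub>E J A) \<inter> space N = {\<omega> \<in> space N. \<forall>i\<in>J. Z i \<omega> \<in> A i}"
    by (auto simp: prod_emb_def PiE_iff space_PiM J(2)[THEN subsetD])
  ultimately show "emeasure (distr M (Pi\<^sub>M Q (\<lambda>_. borel)) (\<lambda>\<omega>. \<lambda>i\<in>Q. Y i \<omega>)) (prod_emb Q (\<lambda>_. borel) J (Pi\<^sub>E J A)) =
    emeasure (distr N (Pi\<^sub>M Q (\<lambda>_. borel)) (\<lambda>\<omega>. \<lambda>i\<in>Q. Z i \<omega>)) (prod_emb Q (\<lambda>_. borel) J (Pi\<^sub>E J A))"
    by (simp add: emeasure_distr[OF paths(1)] emeasure_distr[OF paths(2)] M.emeasure_eq_measure N.emeasure_eq_measure)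
qed simp_all

section \<open>Laws on the space of continuous functions\<close>

text \<open>
  A continuous function is determined by its values on the countable dense set \<open>Q\<close>, and so are the Borel
  sets of \<open>C(D)\<close>. An open set \<open>U\<close> is the union of the cells contained in it, where a cell prescribes, up
  to an error \<open>1 / (m + 1)\<close>, the rational value \<open>r\<close> on the points of \<open>Q\<close> that are closer than
  \<open>1 / (n + 1)\<close> to \<open>x\<close>, for finitely many pairs \<open>(x, r)\<close>. There are countably many cells, and each is a
  countable intersection of conditions on single values. That the cells exhaust \<open>U\<close> follows from
  uniform continuity and compactness.
\<close>

lemma sets_borel_C_subset:
  assumes D: "compact D" and Q: "countable Q" "closure Q = D"
  shows "sets (borel_C D) \<subseteq>
    sets (vimage_algebra (space (borel_C D)) (\<lambda>f. restrict f Q) (Pi\<^sub>M Q (\<lambda>_. borel)))"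
proof -
  define C where "C = space (borel_C D)"
  define V where "V = vimage_algebra C (\<lambda>f. restrict f Q) (Pi\<^sub>M Q (\<lambda>_. borel :: real measure))"
  let ?m = "cfunspace (top_of_set D) (euclidean_metric :: real metric)"
  have C: "C = {f \<in> extensional D. continuous_on D f}"
    by (simp add: C_def space_borel_C D)
  have mspace: "mspace ?m = C"
    by (simp add: C_def borel_C_def space_measure_of_conv)
  have QD: "Q \<subseteq> D" using Q(2) closure_subset by metis
  have evaluation: "(\<lambda>f. f q) \<in> borel_measurable V" if "q \<in> Q" for q
  proof -
    have "(\<lambda>f. restrict f Q) \<in> V \<rightarrow>\<^sub>M Pi\<^sub>M Q (\<lambda>_. borel)"
      unfolding V_def by (rule measurable_vimage_algebra1) (auto simp: space_PiM)
    from measurable_compose[OF this measurable_component_singleton[OF that]] that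
    show ?thesis by simp
  qed
  have space_V: "space V = C" by (simp add: V_def)
  define cell where "cell L n m = {f \<in> C. \<forall>(x, r)\<in>set L. \<forall>q\<in>Q.
    dist x q < 1 / real (Suc n) \<longrightarrow> \<bar>f q - r\<bar> \<le> 1 / real (Suc m)}"
    for L :: "((real \<times> real) \<times> real) list" and n m
  have cell_V: "cell L n m \<in> sets V" for L n m
  proof -
    have "{f \<in> space V. \<forall>xr\<in>set L. \<forall>q\<in>Q. dist (fst xr) q < 1 / real (Suc n) \<longrightarrow>
      \<bar>f q - snd xr\<bar> \<le> 1 / real (Suc m)} \<in> sets V"
      by (intro sets.sets_Collect_countable_All' sets.sets_Collect_imp sets.sets_Collect_const countable_finite Q) 
         (auto intro!: borel_measurable_le borel_measurable_abs borel_measurable_diff evaluation)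
    then show ?thesis by (simp add: cell_def space_V case_prod_beta)
  qed
  have open_V: "U \<in> sets V" if U: "openin (mtopology_of ?m) U" for U
  proof -
    interpret m: Metric_space "mspace ?m" "mdist ?m"
      by (rule Metric_space_mspace_mdist)
    have "openin m.mtopology U" using U by (simp only: mtopology_of_def)
    then have UC: "U \<subseteq> C" and ball: "\<And>f. f \<in> U \<Longrightarrow> \<exists>r>0. m.mball f r \<subseteq> U"
      by (simp_all only: m.openin_mtopology mspace[symmetric])
    define P where "P = {(L, n, m). cell L n m \<subseteq> U} \<inter> lists (Q \<times> \<rat>) \<times> UNIV \<times> UNIV"
    have "countable P"
      unfolding P_def using Q(1) countable_rat
      by (intro countable_Int2 countable_SIGMA countable_lists) auto
    have "f \<in> (\<Union>(L, n, m)\<in>P. cell L n m)" if f: "f \<in> U" for f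
    proof -
      have fC: "f \<in> C" using UC f by auto
      obtain e where e: "0 < e" "m.mball f e \<subseteq> U" using ball[OF f] by auto
      \<comment> \<open>Two elements of the cell constructed below differ by at most \<open>2 / (m + 1)\<close>.\<close>
      obtain m where m: "1 / real (Suc m) < e / 2"
        using reals_Archimedean[of "e / 2"] e(1) by (auto simp: inverse_eq_divide)
      define \<tau> where "\<tau> = 1 / real (Suc m)"
      have \<tau>: "0 < \<tau>" by (simp add: \<tau>_def)
      have "uniformly_continuous_on D f"
        using fC D by (auto simp: C compact_uniformly_continuous)
      then obtain d where d: "0 < d" "\<And>x y. x \<in> D \<Longrightarrow> y \<in> D \<Longrightarrow> dist y x < d \<Longrightarrow> dist (f y) (f x) < \<tau> / 2"
        unfolding uniformly_continuous_on_def using \<tau> by (metis half_gt_zero)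
      obtain n where n: "1 / real (Suc n) < d"
        using reals_Archimedean[OF d(1)] by (auto simp: inverse_eq_divide)
      have "D \<subseteq> (\<Union>x\<in>Q. ball x (1 / real (Suc n)))"
      proof
        fix z assume "z \<in> D"
        then have "\<forall>e>0. \<exists>x\<in>Q. dist x z < e"
          unfolding Q(2)[symmetric] closure_approachable .
        then have "\<exists>x\<in>Q. dist x z < 1 / real (Suc n)"
          by (simp del: of_nat_Suc)
        then show "z \<in> (\<Union>x\<in>Q. ball x (1 / real (Suc n)))" by auto
      qed
      then obtain F where F: "F \<subseteq> Q" "finite F" "D \<subseteq> (\<Union>x\<in>F. ball x (1 / real (Suc n)))"
        by (rule compactE_image[OF D, rotated]) auto
      obtain r where r: "\<And>x. r x \<in> \<rat>" "\<And>x. \<bar>f x - r x\<bar> < \<tau> / 2"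
      proof -
        have "\<exists>y\<in>\<rat>. \<bar>f x - y\<bar> < \<tau> / 2" for x
        proof -
          obtain y where "y \<in> \<rat>" "f x - \<tau> / 2 < y" "y < f x + \<tau> / 2"
            using Rats_dense_in_real[of "f x - \<tau> / 2" "f x + \<tau> / 2"] \<tau> by auto
          moreover from this have "\<bar>f x - y\<bar> < \<tau> / 2" by linarith
          ultimately show ?thesis by blast
        qed
        then show ?thesis using that by metis
      qed
      obtain l where l: "set l = F" using finite_list[OF F(2)] by auto
      \<comment> \<open>The finite net \<open>F\<close> with the rounded values of \<open>f\<close>.\<close>
      define L where "L = map (\<lambda>x. (x, r x)) l"
      have L: "set L = (\<lambda>x. (x, r x)) ` F" by (simp add: L_def l)
      have "f \<in> cell L n m"
        unfolding cell_def L
      proof (clarsimp simp: fC simp del: of_nat_Suc)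
        fix x q assume x: "x \<in> F" and q: "q \<in> Q" and "dist x q < 1 / real (Suc n)"
        then have "dist (f x) (f q) < \<tau> / 2"
          using d(2)[of q x] n F(1) QD by auto
        then have "\<bar>f q - r x\<bar> \<le> \<tau>"
          using r(2)[of x] unfolding dist_real_def by linarith
        then show "\<bar>f q - r x\<bar> \<le> 1 / real (Suc m)" by (simp only: \<tau>_def)
      qed
      moreover have "cell L n m \<subseteq> U"
      proof
        fix g assume g: "g \<in> cell L n m"
        then have gC: "g \<in> C" by (simp add: cell_def)
        have "norm (f q - g q) \<le> 2 * \<tau>" if q: "q \<in> Q" for q
        proof -
          obtain x where x: "x \<in> F" "dist x q < 1 / real (Suc n)"
            using F(3) QD q by auto
          have "\<bar>h q - r x\<bar> \<le> \<tau>" if "h \<in> cell L n m" for h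
            using that x q unfolding cell_def L \<tau>_def by auto
          from this[OF g] this[OF \<open>f \<in> cell L n m\<close>] show ?thesis by simp
        qed
        then have "norm (f z - g z) \<le> 2 * \<tau>" if "z \<in> D" for z
          using continuous_on_closure_norm_le[of Q "\<lambda>z. f z - g z" "2 * \<tau>" z] that fC gC
          by (auto simp: Q(2) C intro!: continuous_intros)
        then have "mdist ?m f g \<le> 2 * \<tau>"
          using \<tau> by (intro mdist_cfunspace_le) (auto simp: dist_real_def)
        also have "\<dots> < e" using m by (simp add: \<tau>_def)
        finally have "g \<in> m.mball f e"
          using fC gC by (simp only: m.in_mball mspace[symmetric])
        then show "g \<in> U" using e(2) by blast
      qed
      moreover have "L \<in> lists (Q \<times> \<rat>)"
        using F(1) r(1) L by auto
      ultimately show ?thesis by (auto simp: P_def)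
    qed
    then have "U = (\<Union>(L, n, m)\<in>P. cell L n m)"
      by (auto simp: P_def)
    moreover have "(\<Union>(L, n, m)\<in>P. cell L n m) \<in> sets V"
      using \<open>countable P\<close> cell_V by (intro sets.countable_UN') auto
    ultimately show ?thesis by simp
  qed
  have "U \<subseteq> mspace ?m" if "openin (mtopology_of ?m) U" for U
    using openin_subset[OF that] by (simp only: topspace_mtopology_of)
  then have "sets (borel_C D) = sigma_sets (space V) {U. openin (mtopology_of ?m) U}"
    unfolding borel_C_def space_V mspace[symmetric] by (intro sets_measure_of) blast
  also have "\<dots> \<subseteq> sets V"
    using open_V by (intro sets.sigma_sets_subset) blast
  finally show ?thesis by (simp add: V_def C_def)
qed

lemma C_path_in_space:
  assumes "compact D"
  shows "C_path D Y \<omega> \<in> space (borel_C D)"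
  unfolding space_borel_C[OF assms] C_path_def
  by (cases "continuous_on D (\<lambda>z. Y z \<omega>)") (auto cong: continuous_on_cong)

text \<open>
  Outside a null set the restriction of the path to \<open>Q\<close> consists of the values of the field itself, so the
  preimage of a Borel set of \<open>C(D)\<close> differs by a null set from an event that is described by the
  countably many variables \<open>Y z\<close> with \<open>z \<in> Q\<close>.
\<close>

lemma C_path_law:
  assumes D: "compact D" and Q: "countable Q" "closure Q = D"
    and Y: "random_field M D Y" "continuous_paths_AE M D Y"
  shows C_path_measurable: "C_path D Y \<in> completion M \<rightarrow>\<^sub>M borel_C D"
    and emeasure_law_on_C: "\<And>A. A \<in> sets (Pi\<^sub>M Q (\<lambda>_. borel)) \<Longrightarrow>
      (\<lambda>f. restrict f Q) -` A \<inter> space (borel_C D) \<in> sets (borel_C D) \<Longrightarrow>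
      emeasure (law_on_C D M Y) ((\<lambda>f. restrict f Q) -` A \<inter> space (borel_C D)) =
      emeasure (distr M (Pi\<^sub>M Q (\<lambda>_. borel)) (\<lambda>\<omega>. \<lambda>z\<in>Q. Y z \<omega>)) A"
proof -
  have QD: "Q \<subseteq> D" using Q(2) closure_subset by metis
  have Y_Q: "(\<lambda>\<omega>. \<lambda>z\<in>Q. Y z \<omega>) \<in> M \<rightarrow>\<^sub>M Pi\<^sub>M Q (\<lambda>_. borel)"
    using Y(1) QD by (intro measurable_restrict) (auto simp: random_field_def)
  let ?B = "\<lambda>A. (\<lambda>f. restrict f Q) -` A \<inter> space (borel_C D)"
  have preimage: "AE \<omega> in completion M. \<omega> \<in> (\<lambda>\<omega>. \<lambda>z\<in>Q. Y z \<omega>) -` A \<inter> space M \<longleftrightarrow>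
    \<omega> \<in> C_path D Y -` ?B A \<inter> space (completion M)" for A
  proof -
    have "AE \<omega> in completion M. continuous_on D (\<lambda>z. Y z \<omega>)"
      using Y(2) by (simp add: continuous_paths_AE_def AE_completion)
    then show ?thesis
    proof eventually_elim
      case (elim \<omega>)
      then have "restrict (C_path D Y \<omega>) Q = (\<lambda>z\<in>Q. Y z \<omega>)"
        using QD by (auto simp: C_path_def restrict_def fun_eq_iff)
      then show ?case using C_path_in_space[OF D, of Y \<omega>] by simp
    qed
  qed
  show meas: "C_path D Y \<in> completion M \<rightarrow>\<^sub>M borel_C D"
  proof (rule measurableI)
    show "C_path D Y \<omega> \<in> space (borel_C D)" for \<omega> by (rule C_path_in_space[OF D])
    fix B assume "B \<in> sets (borel_C D)"
    then have "B \<in> sets (vimage_algebra (space (borel_C D)) (\<lambda>f. restrict f Q) (Pi\<^sub>M Q (\<lambda>_. borel)))"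
      using sets_borel_C_subset[OF D Q] by blast
    then obtain A where A: "A \<in> sets (Pi\<^sub>M Q (\<lambda>_. borel :: real measure))" "B = ?B A"
      by (subst (asm) sets_vimage_algebra2) (auto simp: space_PiM)
    have "(\<lambda>\<omega>. \<lambda>z\<in>Q. Y z \<omega>) -` A \<inter> space M \<in> sets (completion M)"
      using measurable_sets[OF Y_Q A(1)] by simp
    from completion.in_sets_AE[OF preimage this] show "C_path D Y -` B \<inter> space (completion M) \<in> sets (completion M)"
      by (simp add: A(2))
  qed
  fix A :: "(real \<times> real \<Rightarrow> real) set"
  assume A: "A \<in> sets (Pi\<^sub>M Q (\<lambda>_. borel))" and B: "?B A \<in> sets (borel_C D)"
  have "emeasure (law_on_C D M Y) (?B A) = emeasure (completion M) (C_path D Y -` ?B A \<inter> space (completion M))"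
    unfolding law_on_C_def by (rule emeasure_distr[OF meas B])
  also have "\<dots> = emeasure (completion M) ((\<lambda>\<omega>. \<lambda>z\<in>Q. Y z \<omega>) -` A \<inter> space M)"
    using preimage[of A] measurable_sets[OF meas B] measurable_sets[OF Y_Q A]
    by (intro emeasure_eq_AE) auto
  also have "\<dots> = emeasure (distr M (Pi\<^sub>M Q (\<lambda>_. borel)) (\<lambda>\<omega>. \<lambda>z\<in>Q. Y z \<omega>)) A"
    using measurable_sets[OF Y_Q A] by (simp add: emeasure_distr[OF Y_Q A])
  finally show "emeasure (law_on_C D M Y) (?B A) =
    emeasure (distr M (Pi\<^sub>M Q (\<lambda>_. borel)) (\<lambda>\<omega>. \<lambda>z\<in>Q. Y z \<omega>)) A" .
qed

lemma law_on_C_eqI: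
  assumes D: "compact D" and Q: "countable Q" "closure Q = D"
    and Y: "random_field M D Y" "continuous_paths_AE M D Y"
    and Z: "random_field N D Z" "continuous_paths_AE N D Z"
    and eq: "distr M (Pi\<^sub>M Q (\<lambda>_. borel)) (\<lambda>\<omega>. \<lambda>z\<in>Q. Y z \<omega>) =
      distr N (Pi\<^sub>M Q (\<lambda>_. borel)) (\<lambda>\<omega>. \<lambda>z\<in>Q. Z z \<omega>)"
  shows "law_on_C D M Y = law_on_C D N Z"
proof (rule measure_eqI)
  show "sets (law_on_C D M Y) = sets (law_on_C D N Z)" by (simp add: law_on_C_def)
  fix B assume "B \<in> sets (law_on_C D M Y)"
  then have B: "B \<in> sets (borel_C D)" by (simp add: law_on_C_def)
  then have "B \<in> sets (vimage_algebra (space (borel_C D)) (\<lambda>f. restrict f Q) (Pi\<^sub>M Q (\<lambda>_. borel)))"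
    using sets_borel_C_subset[OF D Q] by blast
  then obtain A where A: "A \<in> sets (Pi\<^sub>M Q (\<lambda>_. borel :: real measure))"
    "B = (\<lambda>f. restrict f Q) -` A \<inter> space (borel_C D)"
    by (subst (asm) sets_vimage_algebra2) (auto simp: space_PiM)
  show "emeasure (law_on_C D M Y) B = emeasure (law_on_C D N Z) B"
    using emeasure_law_on_C[OF D Q Y A(1)] emeasure_law_on_C[OF D Q Z A(1)] B eq unfolding A(2) by simp
qed

section \<open>Transfer of path continuity\<close>

text \<open>
  For a countable index set, uniform continuity is an event of the product \<open>\<sigma>\<close>-algebra, since the moduli
  may be restricted to reciprocals of integers. Its probability therefore depends on the joint law
  only.
\<close>

lemma AE_uniformly_continuous_transfer:
  fixes Y :: "'i :: metric_space \<Rightarrow> 'a \<Rightarrow> real" and Z :: "'i \<Rightarrow> 'b \<Rightarrow> real"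
  assumes Q: "countable Q"
    and Y: "\<And>q. q \<in> Q \<Longrightarrow> Y q \<in> borel_measurable M"
    and Z: "\<And>q. q \<in> Q \<Longrightarrow> Z q \<in> borel_measurable N"
    and eq: "distr M (Pi\<^sub>M Q (\<lambda>_. borel)) (\<lambda>\<omega>. \<lambda>z\<in>Q. Y z \<omega>) =
      distr N (Pi\<^sub>M Q (\<lambda>_. borel)) (\<lambda>\<omega>. \<lambda>z\<in>Q. Z z \<omega>)"
    and uc: "AE \<omega> in N. uniformly_continuous_on Q (\<lambda>z. Z z \<omega>)"
  shows "AE \<omega> in M. uniformly_continuous_on Q (\<lambda>z. Y z \<omega>)"
proof -
  have uc_iff: "uniformly_continuous_on Q h \<longleftrightarrow>
    (\<forall>n. \<exists>m. \<forall>p\<in>Q. \<forall>q\<in>Q. dist q p < 1 / real (Suc m) \<longrightarrow> \<bar>h q - h p\<bar> < 1 / real (Suc n))" 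
    (is "_ \<longleftrightarrow> ?R") for h :: "'i \<Rightarrow> real"
  proof
    assume *: "uniformly_continuous_on Q h"
    show ?R
    proof
      fix n
      have "0 < 1 / real (Suc n)" by simp
      then obtain d where "0 < d" and d: "\<forall>p\<in>Q. \<forall>q\<in>Q. dist q p < d \<longrightarrow> dist (h q) (h p) < 1 / real (Suc n)"
        using * unfolding uniformly_continuous_on_def by blast
      obtain m where "1 / real (Suc m) < d"
        using reals_Archimedean[OF \<open>0 < d\<close>] by (auto simp: inverse_eq_divide)
      with d have "\<forall>p\<in>Q. \<forall>q\<in>Q. dist q p < 1 / real (Suc m) \<longrightarrow> \<bar>h q - h p\<bar> < 1 / real (Suc n)"
        unfolding dist_real_def by (meson less_trans)
      then show "\<exists>m. \<forall>p\<in>Q. \<forall>q\<in>Q. dist q p < 1 / real (Suc m) \<longrightarrow> \<bar>h q - h p\<bar> < 1 / real (Suc n)" ..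
    qed
  next
    assume R: ?R
    show "uniformly_continuous_on Q h"
      unfolding uniformly_continuous_on_def
    proof (intro allI impI)
      fix e :: real assume "0 < e"
      obtain n where n: "1 / real (Suc n) < e"
        using reals_Archimedean[OF \<open>0 < e\<close>] by (auto simp: inverse_eq_divide)
      obtain m where "\<forall>p\<in>Q. \<forall>q\<in>Q. dist q p < 1 / real (Suc m) \<longrightarrow> \<bar>h q - h p\<bar> < 1 / real (Suc n)"
        using R by blast
      with n show "\<exists>d>0. \<forall>x\<in>Q. \<forall>x'\<in>Q. dist x' x < d \<longrightarrow> dist (h x') (h x) < e"
        unfolding dist_real_def by (intro exI[of _ "1 / real (Suc m)"]) (auto intro: less_trans simp del: of_nat_Suc)
    qed
  qed
  have restrict: "uniformly_continuous_on Q (\<lambda>z\<in>Q. h z) \<longleftrightarrow> uniformly_continuous_on Q h" for h :: "'i \<Rightarrow> real"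
    by (simp add: uniformly_continuous_on_def)
  let ?P = "Pi\<^sub>M Q (\<lambda>_. borel :: real measure)"
  have event: "{h \<in> space ?P. uniformly_continuous_on Q h} \<in> sets ?P"
    unfolding uc_iff
    by (intro sets.sets_Collect_countable_All sets.sets_Collect_countable_Ex
        sets.sets_Collect_countable_All' sets.sets_Collect_imp sets.sets_Collect_const Q)
      (auto intro!: borel_measurable_less borel_measurable_abs borel_measurable_diff)
  have paths: "(\<lambda>\<omega>. \<lambda>z\<in>Q. Y z \<omega>) \<in> M \<rightarrow>\<^sub>M ?P" "(\<lambda>\<omega>. \<lambda>z\<in>Q. Z z \<omega>) \<in> N \<rightarrow>\<^sub>M ?P"
    using Y Z by (auto intro!: measurable_restrict)
  have "(AE \<omega> in M. uniformly_continuous_on Q (\<lambda>z. Y z \<omega>)) \<longleftrightarrow>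
    (AE h in distr M ?P (\<lambda>\<omega>. \<lambda>z\<in>Q. Y z \<omega>). uniformly_continuous_on Q h)"
    by (subst AE_distr_iff[OF paths(1) event]) (simp only: restrict)
  also have "\<dots> \<longleftrightarrow> (AE \<omega> in N. uniformly_continuous_on Q (\<lambda>z. Z z \<omega>))"
    unfolding eq by (subst AE_distr_iff[OF paths(2) event]) (simp only: restrict)
  finally show ?thesis using uc by simp
qed

text \<open>
  The continuous extension of \<open>f\<close> from \<open>Q\<close> to its closure agrees with \<open>f\<close> on each piece, because both are
  continuous there and coincide on a dense subset of it. So the pieces fit together along their common
  boundary.
\<close>

lemma continuous_on_Union_dense:
  fixes f :: "'a :: metric_space \<Rightarrow> 'b :: complete_space"
  assumes uc: "uniformly_continuous_on Q f"
    and pieces: "\<And>S. S \<in> \<S> \<Longrightarrow> continuous_on S f" "\<And>S. S \<in> \<S> \<Longrightarrow> S \<subseteq> closure (Q \<inter> S)"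
  shows "continuous_on (\<Union>\<S>) f"
proof -
  obtain g where g: "uniformly_continuous_on (closure Q) g" and fg: "\<And>x. x \<in> Q \<Longrightarrow> f x = g x"
    using uniformly_continuous_on_extension_on_closure[OF uc] by metis
  have g_cont: "continuous_on (closure Q) g" by (rule uniformly_continuous_imp_continuous[OF g])
  have "f x = g x" if S: "S \<in> \<S>" and x: "x \<in> S" for x S
  proof -
    obtain u where u: "\<And>n. u n \<in> Q \<inter> S" "u \<longlonglongrightarrow> x"
      using pieces(2)[OF S] x unfolding closure_sequential by (metis subsetD closure_sequential)
    have "(\<lambda>n. f (u n)) \<longlonglongrightarrow> f x"
      using continuous_on_tendsto_compose[OF pieces(1)[OF S] u(2) x] u(1) by auto
    moreover have "x \<in> closure Q"
      using pieces(2)[OF S] x closure_mono[of "Q \<inter> S" Q] by auto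
    then have "(\<lambda>n. g (u n)) \<longlonglongrightarrow> g x"
      using continuous_on_tendsto_compose[OF g_cont u(2)] u(1) closure_subset[of Q]
      by (auto intro!: always_eventually)
    moreover have "f (u n) = g (u n)" for n using fg u(1) by auto
    ultimately show ?thesis by (simp add: LIMSEQ_unique)
  qed
  moreover have "\<Union>\<S> \<subseteq> closure Q"
    using pieces(2) closure_mono[of "Q \<inter> _" Q] by blast
  then have "continuous_on (\<Union>\<S>) g" by (rule continuous_on_subset[OF g_cont])
  ultimately show ?thesis by (subst continuous_on_cong[OF refl]) auto
qed

section \<open>Wiener fields and Ornstein-Uhlenbeck fields\<close>

definition wiener_cov :: "real \<times> real \<Rightarrow> real \<times> real \<Rightarrow> real"
  where "wiener_cov z z' = min (fst z) (fst z') * min (snd z) (snd z')"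

definition bridge_cov :: "real \<times> real \<Rightarrow> real \<times> real \<Rightarrow> real"
  where "bridge_cov z z' = (min (fst z) (fst z') - fst z * fst z') * (min (snd z) (snd z') - snd z * snd z')"

lemma standard_Wiener_field_centered_gaussian:
  assumes "standard_Wiener_field M W"
  shows "centered_gaussian M ({0..} \<times> {0..}) W wiener_cov"
  using assms unfolding standard_Wiener_field_def
  by (intro gauss_field_imp_centered_gaussian) (auto simp: wiener_cov_def)

lemma covariance_scaled:
  assumes "\<And>\<omega>. \<omega> \<in> space M \<Longrightarrow> f \<omega> = c * g \<omega>" "\<And>\<omega>. \<omega> \<in> space M \<Longrightarrow> f' \<omega> = c' * g' \<omega>"
  shows "covariance M f f' = c * c' * covariance M g g'"
proof -
  have "integral\<^sup>L M f = c * integral\<^sup>L M g" "integral\<^sup>L M f' = c' * integral\<^sup>L M g'"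
    using Bochner_Integration.integral_cong[OF refl assms(1)] Bochner_Integration.integral_cong[OF refl assms(2)] by simp_all
  then have "covariance M f f' = (\<integral>\<omega>. c * c' * ((g \<omega> - integral\<^sup>L M g) * (g' \<omega> - integral\<^sup>L M g')) \<partial>M)"
    unfolding covariance_def
    by (intro Bochner_Integration.integral_cong refl) (simp add: assms algebra_simps)
  then show ?thesis by (simp add: covariance_def)
qed

text \<open>
  The covariance is a product of one factor for each of the two parameters; this is one factor.
\<close>

lemma exp_time_change_covariance:
  "exp (- s / 2) * exp (- s' / 2) * min (exp s) (exp s') = exp (- (1 / 2) * \<bar>s' - s\<bar>)" for s s' :: real
  by (cases "s \<le> s'") (auto simp: exp_add[symmetric] min_def field_simps)

proposition exponential_time_change_stationary_OU:
  assumes W: "standard_Wiener_field M W"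
    and X: "\<And>s t \<omega>. \<omega> \<in> space M \<Longrightarrow> X (s, t) \<omega> = exp (- s / 2 - t / 2) * W (exp s, exp t) \<omega>"
  shows "stationary_OU_field M (1/2) (1/2) 1 X"
proof -
  let ?c = "\<lambda>z :: real \<times> real. exp (- fst z / 2 - snd z / 2)" 
  let ?p = "\<lambda>z :: real \<times> real. (exp (fst z), exp (snd z))"
  have X': "X z \<omega> = ?c z * W (?p z) \<omega>" if "\<omega> \<in> space M" for z \<omega>
    using X[OF that, of "fst z" "snd z"] by simp
  have "centered_gaussian M UNIV X (\<lambda>z z'. ?c z * ?c z' * wiener_cov (?p z) (?p z'))"
    by (rule centered_gaussian_linear_image[OF standard_Wiener_field_centered_gaussian[OF W],
          where J = "{()}" and p = "\<lambda>z _. ?p z" and c = "\<lambda>z _. ?c z"]) (auto simp: X')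
  then have gauss: "gauss_field M UNIV X" by (rule centered_gaussian_imp_gauss_field)
  have "AE \<omega> in M. continuous_on ({0..} \<times> {0..}) (\<lambda>z. W z \<omega>)"
    using W by (simp add: standard_Wiener_field_def continuous_paths_AE_def)
  then have paths: "continuous_paths_AE M UNIV X"
    unfolding continuous_paths_AE_def using AE_space
  proof eventually_elim
    case (elim \<omega>)
    have "continuous_on UNIV (\<lambda>z. W (?p z) \<omega>)"
      by (rule continuous_on_compose2[OF elim(1)]) (auto intro!: continuous_intros)
    then have "continuous_on UNIV (\<lambda>z. ?c z * W (?p z) \<omega>)"
      by (intro continuous_intros) auto
    then show ?case using elim(2) by (simp add: X')
  qed
  have mean: "integral\<^sup>L M (X (s, t)) = 0" for s t
  proof -
    have "integral\<^sup>L M (X (s, t)) = (\<integral>\<omega>. exp (- s / 2 - t / 2) * W (exp s, exp t) \<omega> \<partial>M)"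
      by (intro Bochner_Integration.integral_cong refl X)
    then show ?thesis using W by (simp add: standard_Wiener_field_def)
  qed
  have cov: "covariance M (X (s1, t1)) (X (s2, t2)) =
    1\<^sup>2 / (4 * (1 / 2) * (1 / 2)) * exp (- (1 / 2) * \<bar>s2 - s1\<bar> - 1 / 2 * \<bar>t2 - t1\<bar>)" for s1 t1 s2 t2
  proof -
    have "covariance M (X (s1, t1)) (X (s2, t2)) = exp (- s1 / 2 - t1 / 2) * exp (- s2 / 2 - t2 / 2) *
      (min (exp s1) (exp s2) * min (exp t1) (exp t2))"
      using W by (subst covariance_scaled[OF X X]) (simp_all add: standard_Wiener_field_def)
    also have "\<dots> = (exp (- s1 / 2) * exp (- s2 / 2) * min (exp s1) (exp s2)) *
      (exp (- t1 / 2) * exp (- t2 / 2) * min (exp t1) (exp t2))"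
    proof -
      have "exp (- s / 2 - t / 2) = exp (- s / 2) * exp (- t / 2)" for s t :: real
        by (simp add: exp_add[symmetric])
      then show ?thesis by (simp only: ac_simps)
    qed
    also have "\<dots> = exp (- (1 / 2) * \<bar>s2 - s1\<bar> + - (1 / 2) * \<bar>t2 - t1\<bar>)"
      unfolding exp_time_change_covariance exp_add ..
    finally show ?thesis by simp
  qed
  show ?thesis
    unfolding stationary_OU_field_def using gauss paths mean cov by simp
qed

section \<open>Tied-down bridges\<close>

text \<open>
  The bridge is a combination of the values of \<open>W\<close> at four corners. A corner is indexed by a pair of
  truth values, which tell whether the first and the second parameter are moved to \<open>1\<close>; every such move
  contributes a factor \<open>- s\<close> or \<open>- t\<close>.
\<close>

lemma tied_down_Wiener_bridge_centered_gaussian: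
  assumes B: "tied_down_Wiener_bridge N B"
  shows "centered_gaussian N ({0..1} \<times> {0..1}) B bridge_cov"
    and "continuous_paths_AE N ({0..1} \<times> {0..1}) B"
proof -
  obtain W where W: "standard_Wiener_field N W" and B_eq: "\<And>s t \<omega>. s \<in> {0..1} \<Longrightarrow> t \<in> {0..1} \<Longrightarrow> \<omega> \<in> space N \<Longrightarrow>
    B (s, t) \<omega> = W (s, t) \<omega> - s * W (1, t) \<omega> - t * W (s, 1) \<omega> + s * t * W (1, 1) \<omega>"
    using B unfolding tied_down_Wiener_bridge_def by metis
  let ?c = "\<lambda>z j. (if fst j then - fst z else 1) * (if snd j then - snd z else 1 :: real)"
  let ?p = "\<lambda>z j. (if fst j then 1 else fst z, if snd j then 1 else snd z :: real)"
  have corners: "(\<Sum>j\<in>UNIV. h j) = h (False, False) + h (False, True) + h (True, False) + h (True, True)"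
    for h :: "bool \<times> bool \<Rightarrow> real"
    by (simp add: UNIV_Times_UNIV[symmetric] sum.Sigma[symmetric] UNIV_bool sum.cartesian_product' del: UNIV_Times_UNIV)
  show "centered_gaussian N ({0..1} \<times> {0..1}) B bridge_cov"
  proof (rule centered_gaussian_linear_image[OF standard_Wiener_field_centered_gaussian[OF W],
        where J = UNIV and p = ?p and c = ?c])
    show "B z \<omega> = (\<Sum>j\<in>UNIV. ?c z j * W (?p z j) \<omega>)" if "z \<in> {0..1} \<times> {0..1}" "\<omega> \<in> space N" for z \<omega>
      using that by (auto simp: corners B_eq)
    fix z z' :: "real \<times> real" assume "z \<in> {0..1} \<times> {0..1}" "z' \<in> {0..1} \<times> {0..1}"
    then have "min (fst z) 1 = fst z" "min (snd z) 1 = snd z" "min 1 (fst z') = fst z'" "min 1 (snd z') = snd z'"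
      by auto
    then show "bridge_cov z z' = (\<Sum>j\<in>UNIV. \<Sum>j'\<in>UNIV. ?c z j * ?c z' j' * wiener_cov (?p z j) (?p z' j'))"
      unfolding corners by (simp add: wiener_cov_def bridge_cov_def algebra_simps)
  qed auto
  have "AE \<omega> in N. continuous_on ({0..} \<times> {0..}) (\<lambda>z. W z \<omega>)"
    using W by (simp add: standard_Wiener_field_def continuous_paths_AE_def)
  then show "continuous_paths_AE N ({0..1} \<times> {0..1}) B"
    unfolding continuous_paths_AE_def using AE_space
  proof eventually_elim
    case (elim \<omega>)
    have W_comp: "continuous_on ({0..1} \<times> {0..1}) (\<lambda>z. W (h z, k z) \<omega>)"
      if "continuous_on ({0..1} \<times> {0..1}) h" "continuous_on ({0..1} \<times> {0..1}) k"
        "h ` ({0..1} \<times> {0..1}) \<subseteq> {0..}" "k ` ({0..1} \<times> {0..1}) \<subseteq> {0..}" for h k :: "real \<times> real \<Rightarrow> real"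
      by (rule continuous_on_compose2[OF elim(1)]) (use that in \<open>auto intro!: continuous_intros\<close>)
    have "continuous_on ({0..1} \<times> {0..1}) (\<lambda>z. W (fst z, snd z) \<omega> - fst z * W (1, snd z) \<omega> -
      snd z * W (fst z, 1) \<omega> + fst z * snd z * W (1, 1) \<omega>)"
      by (intro continuous_intros W_comp) auto
    then show ?case
      using elim(2) by (subst continuous_on_cong[OF refl]) (auto simp: B_eq)
  qed
qed

lemma sqrt_logit:
  fixes s :: real
  assumes "0 < s" "s < 1"
  shows "sqrt (s * (1 - s)) * exp (- ln (s / (1 - s)) / 2) = 1 - s"
proof -
  have "sqrt (s * (1 - s)) = sqrt ((1 - s)\<^sup>2 * (s / (1 - s)))"
    using assms by (simp add: power2_eq_square)
  also have "\<dots> = (1 - s) * sqrt (s / (1 - s))"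
    using assms by (simp only: real_sqrt_mult real_sqrt_abs)
  also have "sqrt (s / (1 - s)) = exp (ln (s / (1 - s)) / 2)"
    using assms by (simp add: ln_sqrt[symmetric])
  finally show ?thesis
    by (simp add: mult.assoc exp_add[symmetric])
qed

text \<open>
  One factor of the covariance of the rescaled Wiener field. It is the covariance of a Brownian bridge,
  because the odds \<open>s / (1 - s)\<close> increase with \<open>s\<close>.
\<close>

lemma odds_min:
  fixes s s' :: real
  assumes "s < 1" "s' < 1"
  shows "(1 - s) * (1 - s') * min (s / (1 - s)) (s' / (1 - s')) = min s s' - s * s'"
proof -
  have "s / (1 - s) \<le> s' / (1 - s') \<longleftrightarrow> s \<le> s'"
    using assms by (simp add: divide_simps algebra_simps)
  moreover have "(1 - r) * (1 - r') * (r / (1 - r)) = r - r * r'" if "r < 1" for r r' :: real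
  proof -
    have "(1 - r) * (1 - r') * (r / (1 - r)) = (1 - r') * ((1 - r) * (r / (1 - r)))"
      by (simp only: ac_simps)
    also have "(1 - r) * (r / (1 - r)) = r" using that by simp
    finally show ?thesis by (simp add: algebra_simps)
  qed
  from this[OF assms(1), of s'] this[OF assms(2), of s]
  have "(1 - s) * (1 - s') * (s / (1 - s)) = s - s * s'" "(1 - s) * (1 - s') * (s' / (1 - s')) = s' - s * s'"
    by (simp_all only: ac_simps)
  ultimately show ?thesis by (simp add: min_def del: times_divide_eq_right)
qed

lemma logit_time_change_of_OU:
  assumes X: "\<And>s t. X (s, t) = exp (- s / 2 - t / 2) * w (exp s, exp t)"
    and st: "0 < s" "s < 1" "0 < t" "t < 1"
  shows "sqrt (s * t * (1 - s) * (1 - t)) * X (ln (s / (1 - s)), ln (t / (1 - t))) =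
    (1 - s) * (1 - t) * w (s / (1 - s), t / (1 - t))"
proof -
  have "sqrt (s * t * (1 - s) * (1 - t)) = sqrt (s * (1 - s)) * sqrt (t * (1 - t))"
    by (simp add: real_sqrt_mult[symmetric] ac_simps)
  moreover have "exp (- ln (s / (1 - s)) / 2 - ln (t / (1 - t)) / 2) =
    exp (- ln (s / (1 - s)) / 2) * exp (- ln (t / (1 - t)) / 2)"
    by (simp add: exp_add[symmetric])
  moreover have "exp (ln (s / (1 - s))) = s / (1 - s)" "exp (ln (t / (1 - t))) = t / (1 - t)"
    using st by simp_all
  ultimately have "sqrt (s * t * (1 - s) * (1 - t)) * X (ln (s / (1 - s)), ln (t / (1 - t))) =
    (sqrt (s * (1 - s)) * exp (- ln (s / (1 - s)) / 2)) *
    (sqrt (t * (1 - t)) * exp (- ln (t / (1 - t)) / 2)) * w (s / (1 - s), t / (1 - t))"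
    by (simp only: X mult.assoc mult.left_commute)
  then show ?thesis using st by (simp only: sqrt_logit)
qed

text \<open>
  On the boundary the field is zero, which is the Wiener field with coefficient zero, and the bridge covariance vanishes as soon as one of the points lies on the boundary.
\<close>

lemma rescaled_Wiener_centered_gaussian:
  assumes W: "standard_Wiener_field M W"
    and U_interior: "\<And>s t \<omega>. 0 < s \<Longrightarrow> s < 1 \<Longrightarrow> 0 < t \<Longrightarrow> t < 1 \<Longrightarrow> \<omega> \<in> space M \<Longrightarrow>
      U (s, t) \<omega> = (1 - s) * (1 - t) * W (s / (1 - s), t / (1 - t)) \<omega>"
    and U_boundary: "\<And>s t \<omega>. s \<in> {0..1} \<Longrightarrow> t \<in> {0..1} \<Longrightarrow> s \<in> {0, 1} \<or> t \<in> {0, 1} \<Longrightarrow>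
      \<omega> \<in> space M \<Longrightarrow> U (s, t) \<omega> = 0"
  shows "centered_gaussian M ({0..1} \<times> {0..1}) U bridge_cov"
proof (rule centered_gaussian_linear_image[OF standard_Wiener_field_centered_gaussian[OF W]])
  let ?A = "{0<..<1} \<times> {0<..<1} :: (real \<times> real) set"
  let ?c = "\<lambda>z (_ :: unit). if z \<in> ?A then (1 - fst z) * (1 - snd z) else 0"
  let ?p = "\<lambda>z (_ :: unit). if z \<in> ?A then (fst z / (1 - fst z), snd z / (1 - snd z)) else (0, 0)"
  show "finite {()}" by simp
  show "?p z j \<in> {0..} \<times> {0..}" for z j by auto
  show "U z \<omega> = (\<Sum>j\<in>{()}. ?c z j * W (?p z j) \<omega>)" if "z \<in> {0..1} \<times> {0..1}" "\<omega> \<in> space M" for z \<omega>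
    using that U_interior[of "fst z" "snd z" \<omega>] U_boundary[of "fst z" "snd z" \<omega>] by (cases z) auto
  fix z z' :: "real \<times> real" assume z: "z \<in> {0..1} \<times> {0..1}" "z' \<in> {0..1} \<times> {0..1}"
  show "bridge_cov z z' = (\<Sum>j\<in>{()}. \<Sum>j'\<in>{()}. ?c z j * ?c z' j' * wiener_cov (?p z j) (?p z' j'))"
  proof (cases "z \<in> ?A \<and> z' \<in> ?A")
    case True
    then have "fst z < 1" "snd z < 1" "fst z' < 1" "snd z' < 1" by auto
    then show ?thesis using True by (simp add: bridge_cov_def wiener_cov_def odds_min[symmetric])
  next
    case False
    then have "fst z \<in> {0, 1} \<or> snd z \<in> {0, 1} \<or> fst z' \<in> {0, 1} \<or> snd z' \<in> {0, 1}"
      using z by (cases z; cases z') auto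
    then have "bridge_cov z z' = 0"
      using z by (auto simp: bridge_cov_def mem_Times_iff)
    moreover have "?c z j * ?c z' j' = 0" for j j' using False by simp
    ultimately show ?thesis by simp
  qed
qed

text \<open>
  Interior and boundary are treated apart. Continuity across the boundary amounts to a growth bound
  for \<open>W\<close> at infinity, and is obtained later by comparison with the bridge.
\<close>

lemma rescaled_Wiener_continuous_on_pieces:
  assumes W: "standard_Wiener_field M W"
    and U_interior: "\<And>s t \<omega>. 0 < s \<Longrightarrow> s < 1 \<Longrightarrow> 0 < t \<Longrightarrow> t < 1 \<Longrightarrow> \<omega> \<in> space M \<Longrightarrow>
      U (s, t) \<omega> = (1 - s) * (1 - t) * W (s / (1 - s), t / (1 - t)) \<omega>"
    and U_boundary: "\<And>s t \<omega>. s \<in> {0..1} \<Longrightarrow> t \<in> {0..1} \<Longrightarrow> s \<in> {0, 1} \<or> t \<in> {0, 1} \<Longrightarrow>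
      \<omega> \<in> space M \<Longrightarrow> U (s, t) \<omega> = 0"
  shows "AE \<omega> in M. continuous_on ({0<..<1} \<times> {0<..<1}) (\<lambda>z. U z \<omega>) \<and>
    continuous_on ({0..1} \<times> {0..1} - {0<..<1} \<times> {0<..<1}) (\<lambda>z. U z \<omega>)"
proof -
  have "AE \<omega> in M. continuous_on ({0..} \<times> {0..}) (\<lambda>z. W z \<omega>)"
    using W by (simp add: standard_Wiener_field_def continuous_paths_AE_def)
  then show ?thesis
    using AE_space
  proof eventually_elim
    case (elim \<omega>)
    have "continuous_on ({0<..<1} \<times> {0<..<1}) (\<lambda>z. W (fst z / (1 - fst z), snd z / (1 - snd z)) \<omega>)"
      by (rule continuous_on_compose2[OF elim(1)]) (auto intro!: continuous_intros)
    then have "continuous_on ({0<..<1} \<times> {0<..<1})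
      (\<lambda>z. (1 - fst z) * (1 - snd z) * W (fst z / (1 - fst z), snd z / (1 - snd z)) \<omega>)"
      by (intro continuous_intros) auto
    then have "continuous_on ({0<..<1} \<times> {0<..<1}) (\<lambda>z. U z \<omega>)"
      using elim(2) by (subst continuous_on_cong[OF refl]) (auto simp: U_interior)
    moreover have "continuous_on ({0..1} \<times> {0..1} - {0<..<1} \<times> {0<..<1}) (\<lambda>z. U z \<omega>)"
      using elim(2) by (subst continuous_on_cong[OF refl, of _ _ "\<lambda>_. 0"]) (auto intro!: U_boundary)
    ultimately show ?case ..
  qed
qed

theorem proposition2p1:
  fixes M :: "'v measure" and N :: "'w measure"
    and W X U :: "real \<times> real \<Rightarrow> 'v \<Rightarrow> real"
    and B :: "real \<times> real \<Rightarrow> 'w \<Rightarrow> real"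
  assumes W: "standard_Wiener_field M W"
    and X: "\<And>s t \<omega>. \<omega> \<in> space M \<Longrightarrow>
      X (s, t) \<omega> = exp (- s / 2 - t / 2) * W (exp s, exp t) \<omega>"
    and U_interior: "\<And>s t \<omega>. 0 < s \<Longrightarrow> s < 1 \<Longrightarrow> 0 < t \<Longrightarrow> t < 1 \<Longrightarrow> \<omega> \<in> space M \<Longrightarrow>
      U (s, t) \<omega> = sqrt (s * t * (1 - s) * (1 - t)) * X (ln (s / (1 - s)), ln (t / (1 - t))) \<omega>"
    and U_boundary: "\<And>s t \<omega>. s \<in> {0..1} \<Longrightarrow> t \<in> {0..1} \<Longrightarrow> s \<in> {0, 1} \<or> t \<in> {0, 1} \<Longrightarrow>
      \<omega> \<in> space M \<Longrightarrow> U (s, t) \<omega> = 0"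
    and B: "tied_down_Wiener_bridge N B"
  shows "stationary_OU_field M (1/2) (1/2) 1 X \<and>
    same_law_on_C ({0..1} \<times> {0..1}) M U N B"
proof
  show "stationary_OU_field M (1/2) (1/2) 1 X"
    by (rule exponential_time_change_stationary_OU[OF W X])
  let ?D = "{0..1} \<times> {0..1} :: (real \<times> real) set"
  let ?A = "{0<..<1} \<times> {0<..<1} :: (real \<times> real) set"
  have D: "compact ?D" by (intro compact_Times) auto
  have U_rescaled: "U (s, t) \<omega> = (1 - s) * (1 - t) * W (s / (1 - s), t / (1 - t)) \<omega>"
    if "0 < s" "s < 1" "0 < t" "t < 1" "\<omega> \<in> space M" for s t \<omega>
    unfolding U_interior[OF that] by (rule logit_time_change_of_OU) (use X that in auto)
  have U_gauss: "centered_gaussian M ?D U bridge_cov"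
    by (rule rescaled_Wiener_centered_gaussian[OF W U_rescaled U_boundary])
  note B_gauss = tied_down_Wiener_bridge_centered_gaussian(1)[OF B]
  note B_paths = tied_down_Wiener_bridge_centered_gaussian(2)[OF B]
  have fields: "random_field M ?D U" "random_field N ?D B"
    using U_gauss B_gauss by (simp_all add: centered_gaussian_def random_field_def)
  \<comment> \<open>The dense set is chosen such that its parts in the interior and on the boundary are both dense there.\<close>
  obtain Q1 where Q1: "countable Q1" "Q1 \<subseteq> ?A" "?A \<subseteq> closure Q1" by (rule separable)
  obtain Q2 where Q2: "countable Q2" "Q2 \<subseteq> ?D - ?A" "?D - ?A \<subseteq> closure Q2" by (rule separable)
  define Q where "Q = Q1 \<union> Q2"
  have AD: "?A \<union> (?D - ?A) = ?D" by auto
  have Q: "countable Q" "Q \<subseteq> ?D" using Q1 Q2 by (auto simp: Q_def)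
  have closure_Q: "closure Q = ?D"
  proof
    show "closure Q \<subseteq> ?D" using Q(2) D by (simp add: closure_minimal compact_imp_closed)
    show "?D \<subseteq> closure Q" using Un_mono[OF Q1(3) Q2(3)] by (simp only: AD Q_def closure_Un)
  qed
  have laws: "distr M (Pi\<^sub>M Q (\<lambda>_. borel)) (\<lambda>\<omega>. \<lambda>z\<in>Q. U z \<omega>) = distr N (Pi\<^sub>M Q (\<lambda>_. borel)) (\<lambda>\<omega>. \<lambda>z\<in>Q. B z \<omega>)"
    by (rule centered_gaussian_law_unique[OF U_gauss B_gauss Q(2)])
  \<comment> \<open>The bridge has continuous paths on a compact set, and its values on \<open>Q\<close> have the same joint law.\<close>
  have "AE \<omega> in M. uniformly_continuous_on Q (\<lambda>z. U z \<omega>)"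
  proof (rule AE_uniformly_continuous_transfer[OF Q(1) _ _ laws])
    show "U q \<in> borel_measurable M" "B q \<in> borel_measurable N" if "q \<in> Q" for q
      using fields that Q(2) by (auto simp: random_field_def)
    show "AE \<omega> in N. uniformly_continuous_on Q (\<lambda>z. B z \<omega>)"
      using B_paths unfolding continuous_paths_AE_def
    proof eventually_elim
      case (elim \<omega>)
      then have "uniformly_continuous_on ?D (\<lambda>z. B z \<omega>)" by (rule compact_uniformly_continuous[OF _ D])
      then show ?case using Q(2) unfolding uniformly_continuous_on_def by (meson subsetD)
    qed
  qed
  moreover have "AE \<omega> in M. continuous_on ?A (\<lambda>z. U z \<omega>) \<and> continuous_on (?D - ?A) (\<lambda>z. U z \<omega>)"
    by (rule rescaled_Wiener_continuous_on_pieces[OF W U_rescaled U_boundary])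
  ultimately have U_paths: "continuous_paths_AE M ?D U"
    unfolding continuous_paths_AE_def
  proof eventually_elim
    case (elim \<omega>)
    have "?A \<subseteq> closure (Q \<inter> ?A)" "?D - ?A \<subseteq> closure (Q \<inter> (?D - ?A))"
      using Q1 Q2 closure_mono[of Q1 "Q \<inter> ?A"] closure_mono[of Q2 "Q \<inter> (?D - ?A)"] by (auto simp: Q_def)
    then have "continuous_on (\<Union>{?A, ?D - ?A}) (\<lambda>z. U z \<omega>)"
      using elim by (intro continuous_on_Union_dense[OF elim(1)]) auto
    then show ?case using AD by simp
  qed
  show "same_law_on_C ?D M U N B"
    unfolding same_law_on_C_def
    using fields U_paths B_paths C_path_measurable[OF D Q(1) closure_Q fields(1) U_paths]
      C_path_measurable[OF D Q(1) closure_Q fields(2) B_paths]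
      law_on_C_eqI[OF D Q(1) closure_Q fields(1) U_paths fields(2) B_paths laws] by blast
qed

end
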